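(* Let $H$ be a Hopf algebra over a field $\Bbbk$ and let $A$ be a left $H$-comodule algebra. Consider the following conditions: (i) $A$ is left $H$-simple. (ii) $A$ is right $H$-simple. (iii) $A\neq0$, and for every $g\in G(H)$, every $0\neq a\in A_g$ is invertible in $A$. Then each of (i) and (ii) implies (iii). Moreover, if $H$ is pointed, then the three conditions are equivalent.
   Context: Everything is over a field $\Bbbk$; no finite-dimensionality is assumed. A Hopf algebra is pointed if each of its simple subcoalgebras is one-dimensional. $G(H)=\{g\in H\mid\Delta(g)=g\otimes g,\ \varepsilon(g)=1\}$. A left $H$-comodule algebra is an algebra $A$ that is a left $H$-comodule whose coaction $\rho\colon A\to H\otimes A$ is an algebra map. $A_g=\{a\in A\mid\rho(a)=g\otimes a\}$. $A$ is left (resp. right) $H$-simple if $A\neq0$ and its only left (resp. right) ideals that are $H$-subcomodules are $0$ and $A$. *)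

theory Defs
  imports Complex_Main "HOL-Library.Function_Algebras"
begin

text \<open>
  Throughout, \<open>'k\<close> is the ground field, vector spaces are in the sense of the library locale
  \<^locale>\<open>vector_space\<close> (a type together with a scalar multiplication, without restriction
  on the dimension), and subobjects are sets.
\<close>

section \<open>Tensor products of vector spaces\<close>

definition bilinear_map ::
  "('k::field \<Rightarrow> 'a::ab_group_add \<Rightarrow> 'a) \<Rightarrow> ('k \<Rightarrow> 'b::ab_group_add \<Rightarrow> 'b) \<Rightarrow>
   ('k \<Rightarrow> 'c::ab_group_add \<Rightarrow> 'c) \<Rightarrow> ('a \<Rightarrow> 'b \<Rightarrow> 'c) \<Rightarrow> bool" where
  "bilinear_map sA sB sC f \<longleftrightarrow>
     (\<forall>y. Vector_Spaces.linear sA sC (\<lambda>x. f x y)) \<and> (\<forall>x. Vector_Spaces.linear sB sC (f x))"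

text \<open>
  The tensor product of \<open>A\<close> and \<open>B\<close> is realised inside the algebraic dual of the space of bilinear
  forms on \<open>A \<times> B\<close>: the pure tensor of \<open>x\<close> and \<open>y\<close> is the evaluation of bilinear forms at
  \<open>(x, y)\<close> (extended by the junk value 0 to functions that are not bilinear), and the tensor
  product is the span of the pure tensors, with the pointwise operations. The lemmas
  \<open>bilinear_tens\<close>, \<open>tensor_lift\<close> and \<open>tensor_lift_unique\<close> below state the universal property with
  respect to bilinear maps into arbitrary vector spaces.

  Function types carry the pointwise ring operations of the library theory
  \<^theory>\<open>HOL-Library.Function_Algebras\<close>. The addition of tensors
  is the pointwise one, but the pointwise product has nothing to do with the product
  \<open>tensor_mult\<close> of tensors.
\<close>

type_synonym ('k, 'a, 'b) tensor = "('a \<Rightarrow> 'b \<Rightarrow> 'k) \<Rightarrow> 'k"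

definition tens ::
  "('k::field \<Rightarrow> 'a::ab_group_add \<Rightarrow> 'a) \<Rightarrow> ('k \<Rightarrow> 'b::ab_group_add \<Rightarrow> 'b) \<Rightarrow>
   'a \<Rightarrow> 'b \<Rightarrow> ('k, 'a, 'b) tensor" where
  "tens sA sB x y = (\<lambda>\<beta>. if bilinear_map sA sB (*) \<beta> then \<beta> x y else 0)"

definition tscale :: "'k::field \<Rightarrow> ('k, 'a, 'b) tensor \<Rightarrow> ('k, 'a, 'b) tensor" where
  "tscale c t = (\<lambda>\<beta>. c * t \<beta>)"

text \<open>For subspaces \<open>X\<close> of \<open>A\<close> and \<open>Y\<close> of \<open>B\<close>, \<open>tensor_span sA sB X Y\<close> is the subspace
  \<open>X \<otimes> Y\<close> of \<open>A \<otimes> B\<close>.\<close>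

definition tensor_span ::
  "('k::field \<Rightarrow> 'a::ab_group_add \<Rightarrow> 'a) \<Rightarrow> ('k \<Rightarrow> 'b::ab_group_add \<Rightarrow> 'b) \<Rightarrow>
   'a set \<Rightarrow> 'b set \<Rightarrow> ('k, 'a, 'b) tensor set" where
  "tensor_span sA sB X Y = module.span tscale {tens sA sB x y | x y. x \<in> X \<and> y \<in> Y}"

abbreviation tensor_space ::
  "('k::field \<Rightarrow> 'a::ab_group_add \<Rightarrow> 'a) \<Rightarrow> ('k \<Rightarrow> 'b::ab_group_add \<Rightarrow> 'b) \<Rightarrow>
   ('k, 'a, 'b) tensor set" where
  "tensor_space sA sB \<equiv> tensor_span sA sB UNIV UNIV"

text \<open>The linear map \<open>A \<otimes> B \<rightarrow> C\<close> induced by a bilinear map \<open>f\<close>; only its values on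
  \<open>tensor_space sA sB\<close> are determined.\<close>

definition tensor_lift ::
  "('k::field \<Rightarrow> 'a::ab_group_add \<Rightarrow> 'a) \<Rightarrow> ('k \<Rightarrow> 'b::ab_group_add \<Rightarrow> 'b) \<Rightarrow>
   ('k \<Rightarrow> 'c::ab_group_add \<Rightarrow> 'c) \<Rightarrow> ('a \<Rightarrow> 'b \<Rightarrow> 'c) \<Rightarrow> ('k, 'a, 'b) tensor \<Rightarrow> 'c" where
  "tensor_lift sA sB sC f =
     (SOME F. Vector_Spaces.linear tscale sC F \<and> (\<forall>x y. F (tens sA sB x y) = f x y))"

lemma vector_space_tscale: "vector_space (tscale :: 'k::field \<Rightarrow> ('k, 'a, 'b) tensor \<Rightarrow> _)"
  by unfold_locales (auto simp: tscale_def fun_eq_iff algebra_simps)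

lemma vector_space_field_mult: "vector_space ((*) :: 'k::field \<Rightarrow> 'k \<Rightarrow> 'k)"
  by unfold_locales (auto simp: algebra_simps)

lemma bilinear_tens:
  assumes "vector_space sA" "vector_space sB"
  shows "bilinear_map sA sB tscale (tens sA sB)"
proof -
  have 1: "\<beta> (x + x') y = \<beta> x y + \<beta> x' y" "\<beta> (sA c x) y = c * \<beta> x y"
    "\<beta> x (y + y') = \<beta> x y + \<beta> x y'" "\<beta> x (sB c y) = c * \<beta> x y"
    if "bilinear_map sA sB (*) \<beta>" for \<beta> x x' y y' c
    using that by (auto simp: bilinear_map_def Vector_Spaces.linear_iff)
  show ?thesis
    unfolding bilinear_map_def Vector_Spaces.linear_iff
    using assms vector_space_tscale
    by (auto simp: tens_def tscale_def fun_eq_iff 1)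
qed

lemma tensor_lift_exists:
  assumes sC: "vector_space sC" and f: "bilinear_map sA sB sC f"
  shows "\<exists>F. Vector_Spaces.linear tscale sC F \<and> (\<forall>x y. F (tens sA sB x y) = f x y)"
proof -
  interpret T: vector_space tscale by (rule vector_space_tscale)
  interpret C: vector_space sC by (rule sC)
  interpret K: vector_space "(*) :: 'a \<Rightarrow> 'a \<Rightarrow> 'a" by (rule vector_space_field_mult)
  interpret TC: vector_space_pair tscale sC ..
  interpret TK: vector_space_pair tscale "(*) :: 'a \<Rightarrow> 'a \<Rightarrow> 'a" ..
  interpret CK: vector_space_pair sC "(*) :: 'a \<Rightarrow> 'a \<Rightarrow> 'a" ..
  define P where "P = {tens sA sB x y | x y. True}"
  obtain B where B: "B \<subseteq> P" "T.independent B" "P \<subseteq> T.span B"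
    using T.maximal_independent_subset[of P] by blast
  define g where "g b = (let p = (SOME p. b = tens sA sB (fst p) (snd p)) in f (fst p) (snd p))" for b
  obtain F where F: "Vector_Spaces.linear tscale sC F" "\<forall>b\<in>B. F b = g b"
    using TC.linear_independent_extend[OF B(2)] by blast
  have "F (tens sA sB x y) = f x y" for x y
  proof (rule ccontr)
    assume ne: "F (tens sA sB x y) \<noteq> f x y"
    let ?v = "F (tens sA sB x y) - f x y"
    have "C.independent {?v}" using ne by simp
    then obtain \<phi> where \<phi>: "Vector_Spaces.linear sC (*) \<phi>" "\<phi> ?v = 1"
      using CK.linear_independent_extend[of "{?v}" "\<lambda>_. 1"] by auto
    define \<beta> where "\<beta> = (\<lambda>x y. \<phi> (f x y))"
    have \<beta>: "bilinear_map sA sB (*) \<beta>"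
      using f \<phi>(1) unfolding \<beta>_def bilinear_map_def Vector_Spaces.linear_iff by auto
    have l1: "Vector_Spaces.linear tscale (*) (\<lambda>t. \<phi> (F t))"
      using F(1) \<phi>(1) unfolding Vector_Spaces.linear_iff by auto
    have l2: "Vector_Spaces.linear tscale (*) (\<lambda>t. t \<beta>)"
      unfolding Vector_Spaces.linear_iff
      using vector_space_tscale vector_space_field_mult by (auto simp: tscale_def)
    have "\<phi> (F b) = b \<beta>" if b: "b \<in> B" for b
    proof -
      have "\<exists>p. b = tens sA sB (fst p) (snd p)"
        using b B(1) by (auto simp: P_def)
      then have "b = tens sA sB (fst (SOME p. b = tens sA sB (fst p) (snd p)))
          (snd (SOME p. b = tens sA sB (fst p) (snd p)))" by (rule someI_ex)
      then obtain p where p: "b = tens sA sB (fst p) (snd p)" "g b = f (fst p) (snd p)"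
        unfolding g_def Let_def by blast
      then show ?thesis using F(2) b \<beta> by (simp add: tens_def) (simp add: \<beta>_def)
    qed
    moreover have "tens sA sB x y \<in> T.span B" using B(3) by (auto simp: P_def)
    ultimately have "\<phi> (F (tens sA sB x y)) = tens sA sB x y \<beta>"
      using TK.linear_eq_on[OF l1 l2] by blast
    also have "\<dots> = \<phi> (f x y)" using \<beta> by (simp add: tens_def) (simp add: \<beta>_def)
    finally have "\<phi> ?v = 0" using CK.linear_diff[OF \<phi>(1)] by simp
    then show False using \<phi>(2) by simp
  qed
  then show ?thesis using F(1) by blast
qed

lemma tensor_lift:
  assumes "vector_space sC" and "bilinear_map sA sB sC f"
  shows linear_tensor_lift: "Vector_Spaces.linear tscale sC (tensor_lift sA sB sC f)"
    and tensor_lift_tens: "tensor_lift sA sB sC f (tens sA sB x y) = f x y"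
  using someI_ex[OF tensor_lift_exists[OF assms]] unfolding tensor_lift_def by blast+

lemma tensor_lift_unique:
  assumes "vector_space sC" and "bilinear_map sA sB sC f"
    and "Vector_Spaces.linear tscale sC F" and "\<And>x y. F (tens sA sB x y) = f x y"
    and "t \<in> tensor_space sA sB"
  shows "F t = tensor_lift sA sB sC f t"
proof -
  interpret C: vector_space sC by (rule assms(1))
  interpret T: vector_space tscale by (rule vector_space_tscale)
  interpret TC: vector_space_pair tscale sC ..
  show ?thesis
    by (rule TC.linear_eq_on[OF assms(3) linear_tensor_lift[OF assms(1,2)]
          assms(5)[unfolded tensor_span_def]])
      (auto simp: assms(4) tensor_lift_tens[OF assms(1,2)])
qed

section \<open>Algebras\<close>

text \<open>Algebras are associative and unital but not necessarily commutative. The sort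
  \<open>{ring, monoid_mult}\<close> is used instead of the class \<open>ring_1\<close>, because the latter excludes the zero ring.\<close>

locale k_algebra = vector_space scale
  for scale :: "'k::field \<Rightarrow> 'a::{ring,monoid_mult} \<Rightarrow> 'a" +
  assumes scale_mult_left: "scale c x * y = scale c (x * y)"
    and scale_mult_right: "x * scale c y = scale c (x * y)"

text \<open>The multiplication \<open>(x \<otimes> y)(x' \<otimes> y') = xx' \<otimes> yy'\<close> of the algebra \<open>A \<otimes> B\<close>.\<close>

definition tensor_mult ::
  "('k::field \<Rightarrow> 'a::{ring,monoid_mult} \<Rightarrow> 'a) \<Rightarrow> ('k \<Rightarrow> 'b::{ring,monoid_mult} \<Rightarrow> 'b) \<Rightarrow>
   ('k, 'a, 'b) tensor \<Rightarrow> ('k, 'a, 'b) tensor \<Rightarrow> ('k, 'a, 'b) tensor" where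
  "tensor_mult sA sB s t =
     tensor_lift sA sB tscale
       (\<lambda>x y. tensor_lift sA sB tscale (\<lambda>x' y'. tens sA sB (x * x') (y * y')) t) s"

lemma tensor_mult_tens:
  assumes "k_algebra sA" "k_algebra sB"
  shows "tensor_mult sA sB (tens sA sB x y) (tens sA sB x' y') = tens sA sB (x * x') (y * y')"
proof -
  interpret A: k_algebra sA by (rule assms(1))
  interpret B: k_algebra sB by (rule assms(2))
  have t: "tens sA sB (u + u') v = tens sA sB u v + tens sA sB u' v"
    "tens sA sB (sA c u) v = tscale c (tens sA sB u v)"
    "tens sA sB u (v + v') = tens sA sB u v + tens sA sB u v'"
    "tens sA sB u (sB c v) = tscale c (tens sA sB u v)" for u u' v v' c
    using bilinear_tens[OF A.vector_space_axioms B.vector_space_axioms]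
    by (auto simp: bilinear_map_def Vector_Spaces.linear_iff)
  note vs = A.vector_space_axioms B.vector_space_axioms vector_space_tscale
  have 1: "bilinear_map sA sB tscale (\<lambda>x' y'. tens sA sB (x * x') (y * y'))" for x y
    by (auto simp: bilinear_map_def Vector_Spaces.linear_iff vs t algebra_simps
        A.scale_mult_right B.scale_mult_right)
  have 2: "bilinear_map sA sB tscale (\<lambda>x y. tens sA sB (x * x') (y * y'))"
    by (auto simp: bilinear_map_def Vector_Spaces.linear_iff vs t algebra_simps
        A.scale_mult_left B.scale_mult_left)
  show ?thesis
    unfolding tensor_mult_def
    by (simp add: tensor_lift_tens[OF vector_space_tscale 1] tensor_lift_tens[OF vector_space_tscale 2])
qed

text \<open>A left ideal is an additive subgroup closed under left multiplication (closure under additive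
  inverses being the case \<open>a = - 1\<close>); similarly for right ideals.\<close>

definition left_ideal :: "'a::{ring,monoid_mult} set \<Rightarrow> bool" where
  "left_ideal I \<longleftrightarrow> 0 \<in> I \<and> (\<forall>x\<in>I. \<forall>y\<in>I. x + y \<in> I) \<and> (\<forall>a. \<forall>x\<in>I. a * x \<in> I)"

definition right_ideal :: "'a::{ring,monoid_mult} set \<Rightarrow> bool" where
  "right_ideal I \<longleftrightarrow> 0 \<in> I \<and> (\<forall>x\<in>I. \<forall>y\<in>I. x + y \<in> I) \<and> (\<forall>a. \<forall>x\<in>I. x * a \<in> I)"

definition invertible_elem :: "'a::monoid_mult \<Rightarrow> bool" where
  "invertible_elem a \<longleftrightarrow> (\<exists>b. a * b = 1 \<and> b * a = 1)"

section \<open>Left comodules and coalgebras\<close>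

text \<open>
  \<open>coassociative sC \<Delta> sV \<rho>\<close> says that \<open>(\<Delta> \<otimes> id) \<circ> \<rho>\<close> and \<open>(id \<otimes> \<rho>) \<circ> \<rho>\<close> agree as maps from \<open>V\<close>
  to \<open>C \<otimes> (C \<otimes> V)\<close>, the former being composed with the associativity isomorphism. Here
  \<open>C \<otimes> V\<close> is regarded as a subspace of the full type \<open>('k, 'c, 'v) tensor\<close>; over a field
  \<open>C \<otimes> (C \<otimes> V)\<close> then is a subspace of \<open>C \<otimes> ('k, 'c, 'v) tensor\<close>.
\<close>

definition coassociative ::
  "('k::field \<Rightarrow> 'c::ab_group_add \<Rightarrow> 'c) \<Rightarrow> ('c \<Rightarrow> ('k, 'c, 'c) tensor) \<Rightarrow>
   ('k \<Rightarrow> 'v::ab_group_add \<Rightarrow> 'v) \<Rightarrow> ('v \<Rightarrow> ('k, 'c, 'v) tensor) \<Rightarrow> bool" where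
  "coassociative sC \<Delta> sV \<rho> \<longleftrightarrow>
     (\<forall>v. tensor_lift sC sV tscale
            (\<lambda>c w. tensor_lift sC sC tscale (\<lambda>c1 c2. tens sC tscale c1 (tens sC sV c2 w)) (\<Delta> c)) (\<rho> v)
        = tensor_lift sC sV tscale (\<lambda>c w. tens sC tscale c (\<rho> w)) (\<rho> v))"

locale coalgebra = vector_space sC
  for sC :: "'k::field \<Rightarrow> 'c::ab_group_add \<Rightarrow> 'c" +
  fixes \<Delta> :: "'c \<Rightarrow> ('k, 'c, 'c) tensor" and \<epsilon> :: "'c \<Rightarrow> 'k"
  assumes comult_linear: "Vector_Spaces.linear sC tscale \<Delta>"
    and comult_tensor: "\<Delta> c \<in> tensor_space sC sC"
    and counit_linear: "Vector_Spaces.linear sC (*) \<epsilon>"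
    and coassoc: "coassociative sC \<Delta> sC \<Delta>"
    and counit_left: "tensor_lift sC sC sC (\<lambda>c d. sC (\<epsilon> c) d) (\<Delta> x) = x"
    and counit_right: "tensor_lift sC sC sC (\<lambda>c d. sC (\<epsilon> d) c) (\<Delta> x) = x"

locale left_comodule = coalgebra sC \<Delta> \<epsilon> + V: vector_space sV
  for sC :: "'k::field \<Rightarrow> 'c::ab_group_add \<Rightarrow> 'c" and \<Delta> \<epsilon>
    and sV :: "'k \<Rightarrow> 'v::ab_group_add \<Rightarrow> 'v" +
  fixes \<rho> :: "'v \<Rightarrow> ('k, 'c, 'v) tensor"
  assumes coaction_linear: "Vector_Spaces.linear sV tscale \<rho>"
    and coaction_tensor: "\<rho> v \<in> tensor_space sC sV"
    and coaction_coassoc: "coassociative sC \<Delta> sV \<rho>"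
    and coaction_counit: "tensor_lift sC sV sV (\<lambda>c w. sV (\<epsilon> c) w) (\<rho> v) = v"

definition subcoalgebra ::
  "('k::field \<Rightarrow> 'c::ab_group_add \<Rightarrow> 'c) \<Rightarrow> ('c \<Rightarrow> ('k, 'c, 'c) tensor) \<Rightarrow> 'c set \<Rightarrow> bool" where
  "subcoalgebra sC \<Delta> D \<longleftrightarrow> module.subspace sC D \<and> \<Delta> ` D \<subseteq> tensor_span sC sC D D"

definition simple_subcoalgebra ::
  "('k::field \<Rightarrow> 'c::ab_group_add \<Rightarrow> 'c) \<Rightarrow> ('c \<Rightarrow> ('k, 'c, 'c) tensor) \<Rightarrow> 'c set \<Rightarrow> bool" where
  "simple_subcoalgebra sC \<Delta> D \<longleftrightarrow>
     subcoalgebra sC \<Delta> D \<and> D \<noteq> {0} \<and> (\<forall>E. subcoalgebra sC \<Delta> E \<and> E \<subseteq> D \<longrightarrow> E = {0} \<or> E = D)"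

definition pointed ::
  "('k::field \<Rightarrow> 'c::ab_group_add \<Rightarrow> 'c) \<Rightarrow> ('c \<Rightarrow> ('k, 'c, 'c) tensor) \<Rightarrow> bool" where
  "pointed sC \<Delta> \<longleftrightarrow> (\<forall>D. simple_subcoalgebra sC \<Delta> D \<longrightarrow> vector_space.dim sC D = 1)"

definition subcomodule ::
  "('k::field \<Rightarrow> 'c::ab_group_add \<Rightarrow> 'c) \<Rightarrow> ('k \<Rightarrow> 'v::ab_group_add \<Rightarrow> 'v) \<Rightarrow>
   ('v \<Rightarrow> ('k, 'c, 'v) tensor) \<Rightarrow> 'v set \<Rightarrow> bool" where
  "subcomodule sC sV \<rho> W \<longleftrightarrow> module.subspace sV W \<and> \<rho> ` W \<subseteq> tensor_span sC sV UNIV W"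

section \<open>Hopf algebras and comodule algebras\<close>

locale bialgebra = k_algebra sH + coalgebra sH \<Delta> \<epsilon>
  for sH :: "'k::field \<Rightarrow> 'h::{ring,monoid_mult} \<Rightarrow> 'h" and \<Delta> \<epsilon> +
  assumes comult_one: "\<Delta> 1 = tens sH sH 1 1"
    and comult_mult: "\<Delta> (x * y) = tensor_mult sH sH (\<Delta> x) (\<Delta> y)"
    and counit_one: "\<epsilon> 1 = 1"
    and counit_mult: "\<epsilon> (x * y) = \<epsilon> x * \<epsilon> y"

locale hopf_algebra = bialgebra sH \<Delta> \<epsilon>
  for sH :: "'k::field \<Rightarrow> 'h::{ring,monoid_mult} \<Rightarrow> 'h" and \<Delta> \<epsilon> +
  fixes S :: "'h \<Rightarrow> 'h"
  assumes antipode_linear: "Vector_Spaces.linear sH sH S"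
    and antipode_left: "tensor_lift sH sH sH (\<lambda>x y. S x * y) (\<Delta> h) = sH (\<epsilon> h) 1"
    and antipode_right: "tensor_lift sH sH sH (\<lambda>x y. x * S y) (\<Delta> h) = sH (\<epsilon> h) 1"

locale left_comodule_algebra =
  bialgebra sH \<Delta> \<epsilon> + A: k_algebra sA + left_comodule sH \<Delta> \<epsilon> sA \<rho>
  for sH :: "'k::field \<Rightarrow> 'h::{ring,monoid_mult} \<Rightarrow> 'h" and \<Delta> \<epsilon>
    and sA :: "'k \<Rightarrow> 'a::{ring,monoid_mult} \<Rightarrow> 'a" and \<rho> +
  assumes coaction_one: "\<rho> 1 = tens sH sA 1 1"
    and coaction_mult: "\<rho> (a * b) = tensor_mult sH sA (\<rho> a) (\<rho> b)"

definition grouplikes ::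
  "('k::field \<Rightarrow> 'h::ab_group_add \<Rightarrow> 'h) \<Rightarrow> ('h \<Rightarrow> ('k, 'h, 'h) tensor) \<Rightarrow> ('h \<Rightarrow> 'k) \<Rightarrow> 'h set" where
  "grouplikes sH \<Delta> \<epsilon> = {g. \<Delta> g = tens sH sH g g \<and> \<epsilon> g = 1}"

definition homogeneous_part ::
  "('k::field \<Rightarrow> 'h::ab_group_add \<Rightarrow> 'h) \<Rightarrow> ('k \<Rightarrow> 'a::ab_group_add \<Rightarrow> 'a) \<Rightarrow>
   ('a \<Rightarrow> ('k, 'h, 'a) tensor) \<Rightarrow> 'h \<Rightarrow> 'a set" where
  "homogeneous_part sH sA \<rho> g = {a. \<rho> a = tens sH sA g a}"

definition left_H_simple ::
  "('k::field \<Rightarrow> 'h::ab_group_add \<Rightarrow> 'h) \<Rightarrow> ('k \<Rightarrow> 'a::{ring,monoid_mult} \<Rightarrow> 'a) \<Rightarrow>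
   ('a \<Rightarrow> ('k, 'h, 'a) tensor) \<Rightarrow> bool" where
  "left_H_simple sH sA \<rho> \<longleftrightarrow>
     (UNIV :: 'a set) \<noteq> {0} \<and>
     (\<forall>I. left_ideal I \<and> subcomodule sH sA \<rho> I \<longrightarrow> I = {0} \<or> I = UNIV)"

definition right_H_simple ::
  "('k::field \<Rightarrow> 'h::ab_group_add \<Rightarrow> 'h) \<Rightarrow> ('k \<Rightarrow> 'a::{ring,monoid_mult} \<Rightarrow> 'a) \<Rightarrow>
   ('a \<Rightarrow> ('k, 'h, 'a) tensor) \<Rightarrow> bool" where
  "right_H_simple sH sA \<rho> \<longleftrightarrow>
     (UNIV :: 'a set) \<noteq> {0} \<and>
     (\<forall>I. right_ideal I \<and> subcomodule sH sA \<rho> I \<longrightarrow> I = {0} \<or> I = UNIV)"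

definition homogeneous_invertible ::
  "('k::field \<Rightarrow> 'h::ab_group_add \<Rightarrow> 'h) \<Rightarrow> ('h \<Rightarrow> ('k, 'h, 'h) tensor) \<Rightarrow> ('h \<Rightarrow> 'k) \<Rightarrow>
   ('k \<Rightarrow> 'a::{ring,monoid_mult} \<Rightarrow> 'a) \<Rightarrow> ('a \<Rightarrow> ('k, 'h, 'a) tensor) \<Rightarrow> bool" where
  "homogeneous_invertible sH \<Delta> \<epsilon> sA \<rho> \<longleftrightarrow>
     (UNIV :: 'a set) \<noteq> {0} \<and>
     (\<forall>g\<in>grouplikes sH \<Delta> \<epsilon>. \<forall>a\<in>homogeneous_part sH sA \<rho> g. a \<noteq> 0 \<longrightarrow> invertible_elem a)"

end

theory Submission
  imports Defs
begin

text \<open>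
  A subspace \<open>W\<close> of a comodule \<open>V\<close> is a subcomodule iff it is stable under the maps
  \<open>v \<mapsto> (f \<otimes> id) (\<rho> v)\<close> for all linear functionals \<open>f\<close> on the coalgebra.

  Let \<open>a \<noteq> 0\<close> be homogeneous of degree \<open>g\<close>, with \<open>g\<close> grouplike. The left ideals \<open>A a\<close> and
  \<open>{b. b a = 0}\<close> are subcomodules, the latter because \<open>g\<close> is invertible in \<open>H\<close>. If \<open>A\<close> is left
  \<open>H\<close>-simple, the first one gives \<open>b a = 1\<close> for some \<open>b\<close>, and the second one turns
  \<open>(a b - 1) a = 0\<close> into \<open>a b = 1\<close>; the right-hand case is symmetric.

  Conversely, if \<open>H\<close> is pointed, every nonzero subcomodule contains a nonzero homogeneous element of
  grouplike degree: a minimal nonzero finite-dimensional subcomodule \<open>W\<close> has a finite-dimensional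
  coefficient coalgebra, which contains a simple subcoalgebra and hence a grouplike \<open>g\<close>, and the
  coefficient coalgebra is a sum of copies of \<open>W\<close>, so \<open>W\<close> is spanned by an element of degree \<open>g\<close>.
  If such elements are invertible, no proper one-sided ideal can contain one.
\<close>

section \<open>Linear algebra\<close>

abbreviation functional :: "('k::field \<Rightarrow> 'v::ab_group_add \<Rightarrow> 'v) \<Rightarrow> ('v \<Rightarrow> 'k) \<Rightarrow> bool" where
  "functional s \<equiv> Vector_Spaces.linear s (*)"

lemma linear_sum':
  assumes "Vector_Spaces.linear s1 s2 f"
  shows "f (sum g I) = (\<Sum>i\<in>I. f (g i))"
  using module_hom.sum[OF module_hom_linearI[OF assms]] .

lemma linear_add':
  assumes "Vector_Spaces.linear s1 s2 f"
  shows "f (x + y) = f x + f y"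
  using assms by (simp add: Vector_Spaces.linear_iff)

lemma linear_scale':
  assumes "Vector_Spaces.linear s1 s2 f"
  shows "f (s1 c x) = s2 c (f x)"
  using assms by (simp add: Vector_Spaces.linear_iff)

lemma linear_0':
  assumes "Vector_Spaces.linear s1 s2 f"
  shows "f 0 = 0"
  using module_hom.zero[OF module_hom_linearI[OF assms]] .

lemma linear_diff':
  assumes "Vector_Spaces.linear s1 s2 f"
  shows "f (x - y) = f x - f y"
  using module_hom.diff[OF module_hom_linearI[OF assms]] .

lemma linear_compose':
  assumes "Vector_Spaces.linear s1 s2 f" "Vector_Spaces.linear s2 s3 g"
  shows "Vector_Spaces.linear s1 s3 (\<lambda>x. g (f x))"
  using assms by (simp add: Vector_Spaces.linear_iff)

lemma functional_exists:
  assumes "vector_space s" and "v \<noteq> 0"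
  obtains \<phi> where "functional s \<phi>" "\<phi> v = 1"
proof -
  interpret vector_space s by fact
  interpret K: vector_space "(*) :: 'a \<Rightarrow> 'a \<Rightarrow> 'a" by (rule vector_space_field_mult)
  interpret vector_space_pair s "(*) :: 'a \<Rightarrow> 'a \<Rightarrow> 'a" ..
  have "independent {v}" using assms(2) by simp
  from linear_independent_extend[OF this, of "\<lambda>_. 1"] show thesis using that by auto
qed

lemma functional_ext:
  assumes "vector_space s" and "\<And>\<phi>. functional s \<phi> \<Longrightarrow> \<phi> v = \<phi> w"
  shows "v = w"
proof (rule ccontr)
  assume "v \<noteq> w"
  then obtain \<phi> where \<phi>: "functional s \<phi>" "\<phi> (v - w) = 1"
    using functional_exists[OF assms(1), of "v - w"] by auto
  show False using linear_diff'[OF \<phi>(1), of v w] assms(2)[OF \<phi>(1)] \<phi>(2) by simp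
qed

context vector_space
begin

text \<open>A strictly smaller subspace with \<open>P\<close> has a basis that stays independent
  when a vector of \<open>W\<close> is added, so this basis has fewer elements than \<open>S\<close>
  and can replace it in the induction. \<open>P\<close> is left open so that it can mean nonzero
  subcoalgebra or nonzero subcomodule.\<close>

lemma minimal_subspace_exists:
  assumes "finite S" and "W \<subseteq> span S" and "P W" and sub: "\<And>X. P X \<Longrightarrow> subspace X"
  shows "\<exists>M\<subseteq>W. P M \<and> (\<forall>N\<subseteq>M. P N \<longrightarrow> N = M)"
  using assms(1-3)
proof (induction "card S" arbitrary: S W rule: less_induct)
  case less
  show ?case
  proof (cases "\<forall>N\<subseteq>W. P N \<longrightarrow> N = W")
    case True
    then show ?thesis using less.prems by blast
  next
    case False
    then obtain N where N: "N \<subseteq> W" "P N" "N \<noteq> W" by blast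
    then obtain w where w: "w \<in> W" "w \<notin> N" by blast
    obtain B where B: "B \<subseteq> N" "independent B" "N \<subseteq> span B"
      using maximal_independent_subset by blast
    have "span B = N" using span_subspace B(1,3) sub[OF N(2)] by blast
    then have "independent (insert w B)" "w \<notin> B"
      using w(2) B(1) independent_insertI[OF _ B(2), of w] by blast+
    moreover have "insert w B \<subseteq> span S" using w(1) B(1) N(1) less.prems by blast
    ultimately have "finite B" "card B < card S"
      using independent_span_bound[OF less.prems(1), of "insert w B"] by auto
    from less.hyps[OF this(2,1) B(3) N(2)] obtain M
      where "M \<subseteq> N" "P M" "\<forall>N\<subseteq>M. P N \<longrightarrow> N = M" by (elim exE conjE)
    then show ?thesis using N(1) by (intro exI[of _ M]) auto
  qed
qed

end

section \<open>Slices of tensors\<close>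

lemma bilinear_add_left: "bilinear_map sA sB sC f \<Longrightarrow> f (x + x') y = f x y + f x' y"
  and bilinear_add_right: "bilinear_map sA sB sC f \<Longrightarrow> f x (y + y') = f x y + f x y'"
  and bilinear_scale_left: "bilinear_map sA sB sC f \<Longrightarrow> f (sA c x) y = sC c (f x y)"
  and bilinear_scale_right: "bilinear_map sA sB sC f \<Longrightarrow> f x (sB c y) = sC c (f x y)"
  by (auto simp: bilinear_map_def Vector_Spaces.linear_iff)

text \<open>The scalars of a linear combination are absorbed into the left factors, which is why
  \<open>X\<close> has to be a subspace while \<open>Y\<close> may be any set.\<close>

lemma span_bilinear_image_obtain:
  assumes p: "bilinear_map sX sY sT p"
    and X: "module.subspace sX X" and t: "t \<in> module.span sT {p x y | x y. x \<in> X \<and> y \<in> Y}"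
  obtains n :: nat and x y where "\<And>i. i < n \<Longrightarrow> x i \<in> X" "\<And>i. i < n \<Longrightarrow> y i \<in> Y"
    "t = (\<Sum>i<n. p (x i) (y i))"
proof -
  interpret X: vector_space sX using p by (auto simp: bilinear_map_def Vector_Spaces.linear_iff)
  interpret T: vector_space sT using p by (auto simp: bilinear_map_def Vector_Spaces.linear_iff)
  obtain I r where I: "finite I" "I \<subseteq> {p x y | x y. x \<in> X \<and> y \<in> Y}" "t = (\<Sum>a\<in>I. sT (r a) a)"
    using t unfolding T.span_explicit by blast
  have "\<forall>a\<in>I. \<exists>x y. a = p x y \<and> x \<in> X \<and> y \<in> Y" using I(2) by blast
  then obtain x y where xy: "\<And>a. a \<in> I \<Longrightarrow> a = p (x a) (y a) \<and> x a \<in> X \<and> y a \<in> Y"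
    by metis
  have "t = (\<Sum>a\<in>I. p (sX (r a) (x a)) (y a))"
    unfolding I(3) bilinear_scale_left[OF p] using xy by (intro sum.cong) auto
  moreover obtain h n where h: "bij_betw h {..<n::nat} I"
    using ex_bij_betw_nat_finite[OF I(1)] by (auto simp: atLeast0LessThan)
  ultimately have "t = (\<Sum>i<n. p (sX (r (h i)) (x (h i))) (y (h i)))"
    by (simp add: sum.reindex_bij_betw[OF h, of "\<lambda>a. p (sX (r a) (x a)) (y a)"])
  moreover have "sX (r (h i)) (x (h i)) \<in> X" "y (h i) \<in> Y" if "i < n" for i
    using xy[of "h i"] bij_betwE[OF h] that X.subspace_scale[OF X] by auto
  ultimately show thesis
    using that[of n "\<lambda>i. sX (r (h i)) (x (h i))" "\<lambda>i. y (h i)"] by blast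
qed

text \<open>Stated for an arbitrary bilinear map in place of the tensor product, so that it also applies
  to the tensor product with its factors exchanged.\<close>

lemma span_bilinear_image_slices:
  assumes p: "bilinear_map sX sY sT p"
    and X: "module.subspace sX X" and Y: "module.subspace sY Y"
    and L: "\<And>\<phi>. functional sY \<phi> \<Longrightarrow> Vector_Spaces.linear sT sX (L \<phi>)"
    and Lp: "\<And>\<phi> x y. functional sY \<phi> \<Longrightarrow> L \<phi> (p x y) = sX (\<phi> y) x"
    and t: "t \<in> module.span sT {p x y | x y. x \<in> UNIV \<and> y \<in> Y}"
    and LX: "\<And>\<phi>. functional sY \<phi> \<Longrightarrow> L \<phi> t \<in> X"
  shows "t \<in> module.span sT {p x y | x y. x \<in> X \<and> y \<in> Y}"
proof -
  interpret X: vector_space sX using p by (auto simp: bilinear_map_def Vector_Spaces.linear_iff)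
  interpret Y: vector_space sY using p by (auto simp: bilinear_map_def Vector_Spaces.linear_iff)
  interpret T: vector_space sT using p by (auto simp: bilinear_map_def Vector_Spaces.linear_iff)
  interpret K: vector_space "(*) :: 'a \<Rightarrow> 'a \<Rightarrow> 'a" by (rule vector_space_field_mult)
  interpret YK: vector_space_pair sY "(*) :: 'a \<Rightarrow> 'a \<Rightarrow> 'a" ..
  interpret YY: vector_space_pair sY sY ..
  obtain n x y where xy: "\<And>i. i < n \<Longrightarrow> y i \<in> Y" "t = (\<Sum>i<n::nat. p (x i) (y i))"
    using span_bilinear_image_obtain[OF p X.subspace_UNIV t] by blast
  define I where "I = {..<n}"
  have I: "finite I" "\<And>i. i \<in> I \<Longrightarrow> y i \<in> Y" "t = (\<Sum>i\<in>I. p (x i) (y i))"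
    using xy by (auto simp: I_def)
  \<comment> \<open>Trading the \<open>y i\<close> for a basis \<open>B\<close> of their span makes
    the left coefficients of \<open>t\<close> unique, hence recoverable by slicing.\<close>
  obtain B where B: "B \<subseteq> Y.span (y ` I)" "Y.independent B" "Y.span (y ` I) \<subseteq> Y.span B"
    using Y.maximal_independent_subset by blast
  have BY: "B \<subseteq> Y"
    using B(1) Y.span_minimal[OF _ Y, of "y ` I"] I(2) by blast
  have finB: "finite B" using Y.independent_span_bound[OF _ B(2,1)] I(1) by blast
  \<comment> \<open>The dual basis of \<open>B\<close>, extended to functionals on the whole space,
    since \<open>L\<close> is only controlled at such functionals.\<close>
  have "\<exists>\<phi>. functional sY \<phi> \<and> (\<forall>b'\<in>B. \<phi> b' = (if b' = b then 1 else 0))" for b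
    by (rule YK.linear_independent_extend[OF B(2)])
  then obtain \<phi> where \<phi>: "\<And>b. functional sY (\<phi> b)"
    "\<And>b b'. b' \<in> B \<Longrightarrow> \<phi> b b' = (if b' = b then 1 else 0)"
    by metis
  have expand: "(\<Sum>b\<in>B. sY (\<phi> b v) b) = v" if v: "v \<in> Y.span B" for v
  proof (rule YY.linear_eq_on[OF _ _ v])
    show "Vector_Spaces.linear sY sY (\<lambda>v. \<Sum>b\<in>B. sY (\<phi> b v) b)"
      using \<phi>(1) Y.vector_space_axioms
      by (simp add: Vector_Spaces.linear_iff Y.scale_left_distrib sum.distrib Y.scale_sum_right)
    show "Vector_Spaces.linear sY sY (\<lambda>v. v)" by (rule Y.linear_ident)
    fix b' assume "b' \<in> B"
    then show "(\<Sum>b\<in>B. sY (\<phi> b b') b) = b'"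
      using finB by (simp add: \<phi>(2) if_distrib[of "\<lambda>c. sY c _"] cong: if_cong)
  qed
  \<comment> \<open>Expanding \<open>y i\<close> in \<open>B\<close> moves its coordinates to the
    left factor, where they form a slice of \<open>p (x i) (y i)\<close>. After the sums are
    swapped, linearity of \<open>L\<close> collects these into the slices of \<open>t\<close>, which
    lie in \<open>X\<close>.\<close>
  have "t = (\<Sum>i\<in>I. \<Sum>b\<in>B. p (L (\<phi> b) (p (x i) (y i))) b)"
    unfolding I(3)
  proof (rule sum.cong[OF refl])
    fix i assume "i \<in> I"
    then have "y i \<in> Y.span B" using B(3) by (auto intro: Y.span_base)
    have lin: "Vector_Spaces.linear sY sT (p (x i))" using p by (simp add: bilinear_map_def)
    have "p (x i) (y i) = p (x i) (\<Sum>b\<in>B. sY (\<phi> b (y i)) b)"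
      by (simp add: expand[OF \<open>y i \<in> Y.span B\<close>])
    also have "\<dots> = (\<Sum>b\<in>B. p (x i) (sY (\<phi> b (y i)) b))" by (rule linear_sum'[OF lin])
    also have "\<dots> = (\<Sum>b\<in>B. p (L (\<phi> b) (p (x i) (y i))) b)"
      by (simp only: Lp[OF \<phi>(1)] bilinear_scale_left[OF p] bilinear_scale_right[OF p])
    finally show "p (x i) (y i) = (\<Sum>b\<in>B. p (L (\<phi> b) (p (x i) (y i))) b)" .
  qed
  also have "\<dots> = (\<Sum>b\<in>B. \<Sum>i\<in>I. p (L (\<phi> b) (p (x i) (y i))) b)" by (rule sum.swap)
  also have "\<dots> = (\<Sum>b\<in>B. p (L (\<phi> b) t) b)"
  proof (rule sum.cong[OF refl])
    fix b
    have lin: "Vector_Spaces.linear sX sT (\<lambda>x. p x b)" using p by (simp add: bilinear_map_def)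
    show "(\<Sum>i\<in>I. p (L (\<phi> b) (p (x i) (y i))) b) = p (L (\<phi> b) t) b"
      unfolding I(3) linear_sum'[OF L[OF \<phi>(1)]] by (rule linear_sum'[OF lin, symmetric])
  qed
  finally have "t = (\<Sum>b\<in>B. p (L (\<phi> b) t) b)" .
  moreover have "\<dots> \<in> T.span {p x y | x y. x \<in> X \<and> y \<in> Y}"
    using LX[OF \<phi>(1)] BY by (intro T.span_sum T.span_base) auto
  ultimately show ?thesis by simp
qed

text \<open>The contraction \<open>f \<otimes> id\<close> of the first factor; \<open>rslice\<close>
  is the contraction \<open>id \<otimes> \<phi>\<close> of the second.\<close>

definition lslice ::
  "('k::field \<Rightarrow> 'a::ab_group_add \<Rightarrow> 'a) \<Rightarrow> ('k \<Rightarrow> 'b::ab_group_add \<Rightarrow> 'b) \<Rightarrow>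
   ('a \<Rightarrow> 'k) \<Rightarrow> ('k, 'a, 'b) tensor \<Rightarrow> 'b" where
  "lslice sA sB f = tensor_lift sA sB sB (\<lambda>x y. sB (f x) y)"

definition rslice ::
  "('k::field \<Rightarrow> 'a::ab_group_add \<Rightarrow> 'a) \<Rightarrow> ('k \<Rightarrow> 'b::ab_group_add \<Rightarrow> 'b) \<Rightarrow>
   ('b \<Rightarrow> 'k) \<Rightarrow> ('k, 'a, 'b) tensor \<Rightarrow> 'a" where
  "rslice sA sB \<phi> = tensor_lift sA sB sA (\<lambda>x y. sA (\<phi> y) x)"

section \<open>Contractions of tensors and the subspaces X \<otimes> Y that they detect\<close>

context vector_space_pair
begin

lemmas bilinear_tens' = bilinear_tens[OF vs1.vector_space_axioms vs2.vector_space_axioms]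

lemma bilinear_lslice:
  assumes "functional s1 f" shows "bilinear_map s1 s2 s2 (\<lambda>x y. s2 (f x) y)"
  using assms vs2.vector_space_axioms vs1.vector_space_axioms
  by (simp add: bilinear_map_def Vector_Spaces.linear_iff vs2.scale_left_distrib
      vs2.scale_right_distrib mult.commute)

lemma bilinear_rslice:
  assumes "functional s2 f" shows "bilinear_map s1 s2 s1 (\<lambda>x y. s1 (f y) x)"
  using assms vs2.vector_space_axioms vs1.vector_space_axioms
  by (simp add: bilinear_map_def Vector_Spaces.linear_iff vs1.scale_left_distrib
      vs1.scale_right_distrib mult.commute)

lemma linear_lslice: "functional s1 f \<Longrightarrow> Vector_Spaces.linear tscale s2 (lslice s1 s2 f)"
  unfolding lslice_def by (rule linear_tensor_lift[OF vs2.vector_space_axioms bilinear_lslice])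

lemma linear_rslice: "functional s2 f \<Longrightarrow> Vector_Spaces.linear tscale s1 (rslice s1 s2 f)"
  unfolding rslice_def by (rule linear_tensor_lift[OF vs1.vector_space_axioms bilinear_rslice])

lemma lslice_tens: "functional s1 f \<Longrightarrow> lslice s1 s2 f (tens s1 s2 x y) = s2 (f x) y"
  unfolding lslice_def by (rule tensor_lift_tens[OF vs2.vector_space_axioms bilinear_lslice])

lemma rslice_tens: "functional s2 f \<Longrightarrow> rslice s1 s2 f (tens s1 s2 x y) = s1 (f y) x"
  unfolding rslice_def by (rule tensor_lift_tens[OF vs1.vector_space_axioms bilinear_rslice])

lemma lslice_sum: "functional s1 f \<Longrightarrow>
    lslice s1 s2 f (\<Sum>i\<in>I. tens s1 s2 (x i) (y i)) = (\<Sum>i\<in>I. s2 (f (x i)) (y i))"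
  by (simp add: linear_sum'[OF linear_lslice] lslice_tens)

lemma rslice_sum: "functional s2 f \<Longrightarrow>
    rslice s1 s2 f (\<Sum>i\<in>I. tens s1 s2 (x i) (y i)) = (\<Sum>i\<in>I. s1 (f (y i)) (x i))"
  by (simp add: linear_sum'[OF linear_rslice] rslice_tens)

lemma tensor_lift_sum:
  assumes "vector_space s3" "bilinear_map s1 s2 s3 f"
  shows "tensor_lift s1 s2 s3 f (\<Sum>i\<in>I. tens s1 s2 (x i) (y i)) = (\<Sum>i\<in>I. f (x i) (y i))"
  by (simp add: linear_sum'[OF linear_tensor_lift[OF assms]] tensor_lift_tens[OF assms])

lemma tensor_span_sum:
  assumes "\<And>i. i \<in> I \<Longrightarrow> x i \<in> X" "\<And>i. i \<in> I \<Longrightarrow> y i \<in> Y"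
  shows "(\<Sum>i\<in>I. tens s1 s2 (x i) (y i)) \<in> tensor_span s1 s2 X Y"
proof -
  interpret T: vector_space "tscale :: 'a \<Rightarrow> ('a, 'b, 'c) tensor \<Rightarrow> _" by (rule vector_space_tscale)
  show ?thesis unfolding tensor_span_def using assms by (intro T.span_sum T.span_base) auto
qed

lemma tensor_span_obtain:
  assumes "t \<in> tensor_span s1 s2 X Y" "vs1.subspace X"
  obtains n :: nat and x y where "\<And>i. i < n \<Longrightarrow> x i \<in> X" "\<And>i. i < n \<Longrightarrow> y i \<in> Y"
    "t = (\<Sum>i<n. tens s1 s2 (x i) (y i))"
  by (rule span_bilinear_image_obtain[OF bilinear_tens' assms(2) assms(1)[unfolded tensor_span_def]])
    (rule that)

lemma tensor_span_left_slices:
  assumes "vs1.subspace X" "vs2.subspace Y" "t \<in> tensor_span s1 s2 UNIV Y"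
    and "\<And>\<phi>. functional s2 \<phi> \<Longrightarrow> rslice s1 s2 \<phi> t \<in> X"
  shows "t \<in> tensor_span s1 s2 X Y"
  unfolding tensor_span_def
  by (rule span_bilinear_image_slices[where L="rslice s1 s2", OF bilinear_tens' assms(1,2)
        linear_rslice rslice_tens assms(3)[unfolded tensor_span_def] assms(4)])

text \<open>The general lemma on bilinear images with the two factors exchanged; \<open>flip\<close>
  identifies the generators of the spans.\<close>

lemma tensor_span_right_slices:
  assumes "vs1.subspace X" "vs2.subspace Y" "t \<in> tensor_span s1 s2 X UNIV"
    and "\<And>f. functional s1 f \<Longrightarrow> lslice s1 s2 f t \<in> Y"
  shows "t \<in> tensor_span s1 s2 X Y"
proof -
  have flip: "{tens s1 s2 y x | x y. x \<in> Z \<and> y \<in> X} = {tens s1 s2 x y | x y. x \<in> X \<and> y \<in> Z}"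
    for Z by blast
  have p: "bilinear_map s2 s1 tscale (\<lambda>y x. tens s1 s2 x y)"
    using bilinear_tens' by (simp add: bilinear_map_def)
  have t: "t \<in> module.span tscale {tens s1 s2 y x | x y. x \<in> UNIV \<and> y \<in> X}"
    using assms(3) unfolding tensor_span_def flip .
  have "t \<in> module.span tscale {tens s1 s2 y x | x y. x \<in> Y \<and> y \<in> X}"
    by (rule span_bilinear_image_slices[where L="lslice s1 s2", OF p assms(2,1) linear_lslice
          lslice_tens t assms(4)])
  then show ?thesis unfolding tensor_span_def flip .
qed

lemma lslice_tensor_span:
  assumes "functional s1 f" "vs2.subspace Y" "t \<in> tensor_span s1 s2 UNIV Y"
  shows "lslice s1 s2 f t \<in> Y"
proof -
  obtain n x y where t: "\<And>i. i < n \<Longrightarrow> y i \<in> Y" "t = (\<Sum>i<n::nat. tens s1 s2 (x i) (y i))"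
    using tensor_span_obtain[OF assms(3) vs1.subspace_UNIV] by blast
  show ?thesis
    unfolding t(2) lslice_sum[OF assms(1)]
    using t(1) assms(2) by (intro vs2.subspace_sum vs2.subspace_scale) auto
qed

lemma tensor_span_zero_right: "tensor_span s1 s2 X {0} \<subseteq> {0}"
proof -
  interpret T: vector_space "tscale :: 'a \<Rightarrow> ('a, 'b, 'c) tensor \<Rightarrow> _" by (rule vector_space_tscale)
  have "tens s1 s2 x 0 = 0" for x
    using bilinear_scale_right[OF bilinear_tens', where x=x and c=0 and y=0] by simp
  then show ?thesis unfolding tensor_span_def by (intro T.span_minimal) auto
qed

text \<open>All slices of the difference lie in \<open>{0}\<close>, so the difference lies in
  \<open>tensor_span s1 s2 UNIV {0}\<close>, which is trivial.\<close>

lemma tensor_eqI: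
  assumes "t \<in> tensor_space s1 s2" "t' \<in> tensor_space s1 s2"
    and eq: "\<And>f. functional s1 f \<Longrightarrow> lslice s1 s2 f t = lslice s1 s2 f t'"
  shows "t = t'"
proof -
  interpret T: vector_space "tscale :: 'a \<Rightarrow> ('a, 'b, 'c) tensor \<Rightarrow> _" by (rule vector_space_tscale)
  have "t - t' \<in> tensor_span s1 s2 UNIV {0}"
  proof (rule tensor_span_right_slices)
    show "t - t' \<in> tensor_space s1 s2"
      using assms(1,2) unfolding tensor_span_def by (rule T.span_diff)
    show "lslice s1 s2 f (t - t') \<in> {0}" if "functional s1 f" for f
      using eq[OF that] linear_diff'[OF linear_lslice[OF that]] by simp
  qed auto
  then show ?thesis using tensor_span_zero_right by fastforce
qed

end

section \<open>Comodules over pointed coalgebras\<close>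

context coalgebra
begin

interpretation CC: vector_space_pair sC sC ..

text \<open>On a line spanned by \<open>e\<close> the coproduct of \<open>e\<close> is
  \<open>l\<close> times e \<otimes> e, and the counit law forces
  \<open>l * \<epsilon> e = 1\<close>. Hence \<open>e\<close> rescaled by \<open>l\<close> is
  grouplike.\<close>

lemma subcoalgebra_grouplike_of_dim_1:
  assumes D: "subcoalgebra sC \<Delta> D" and dim: "dim D = 1"
  shows "\<exists>g\<in>D. g \<in> grouplikes sC \<Delta> \<epsilon>"
proof -
  have subD: "subspace D" using D by (simp add: subcoalgebra_def)
  obtain B where B: "B \<subseteq> D" "independent B" "D \<subseteq> span B" "card B = dim D"
    using basis_exists by blast
  then obtain e where e: "B = {e}" using dim by (auto simp: card_1_singleton_iff)
  have eD: "e \<in> D" using B e by blast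
  have e0: "e \<noteq> 0" using B(2) e by simp
  have "\<Delta> e \<in> tensor_span sC sC D D" using D eD by (auto simp: subcoalgebra_def)
  then obtain n x y where xy: "\<And>i. i < n \<Longrightarrow> x i \<in> D" "\<And>i. i < n \<Longrightarrow> y i \<in> D"
    "\<Delta> e = (\<Sum>i<n::nat. tens sC sC (x i) (y i))"
    using CC.tensor_span_obtain[OF _ subD] by blast
  have "\<forall>d\<in>D. \<exists>k. d = sC k e"
    using B(3) unfolding e span_singleton by blast
  then obtain q where "\<forall>d\<in>D. d = sC (q d) e" by (rule bchoice[THEN exE])
  then have ab: "x i = sC (q (x i)) e" "y i = sC (q (y i)) e" if "i < n" for i
    using xy(1,2) that by blast+
  define l where "l = (\<Sum>i<n. q (x i) * q (y i))"
  interpret T: vector_space "tscale :: 'k \<Rightarrow> ('k, 'c, 'c) tensor \<Rightarrow> _" by (rule vector_space_tscale)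
  note bil = bilinear_scale_left[OF CC.bilinear_tens'] bilinear_scale_right[OF CC.bilinear_tens']
  have \<Delta>e: "\<Delta> e = tscale l (tens sC sC e e)"
    unfolding xy(3) l_def T.scale_sum_left
  proof (rule sum.cong[OF refl])
    fix i assume "i \<in> {..<n}"
    then have "tens sC sC (x i) (y i) = tens sC sC (sC (q (x i)) e) (sC (q (y i)) e)"
      using ab by simp
    then show "tens sC sC (x i) (y i) = tscale (q (x i) * q (y i)) (tens sC sC e e)"
      by (simp only: bil T.scale_scale mult.commute)
  qed
  have "lslice sC sC \<epsilon> (\<Delta> e) = e" unfolding lslice_def by (rule counit_left)
  then have "sC (l * \<epsilon> e) e = sC 1 e"
    unfolding \<Delta>e using counit_linear
    by (simp add: linear_scale'[OF CC.linear_lslice] CC.lslice_tens)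
  then have l1: "l * \<epsilon> e = 1" using e0 by (simp only: scale_cancel_right) simp
  have "\<Delta> (sC l e) = tens sC sC (sC l e) (sC l e)"
    by (simp add: linear_scale'[OF comult_linear] \<Delta>e bil)
  moreover have "\<epsilon> (sC l e) = 1" using l1 by (simp add: linear_scale'[OF counit_linear])
  moreover have "sC l e \<in> D" using subspace_scale[OF subD eD] .
  ultimately show ?thesis by (auto simp: grouplikes_def)
qed

text \<open>The finite spanning set yields a minimal nonzero subcoalgebra inside \<open>D\<close>;
  it is simple, hence a line by pointedness.\<close>

lemma pointed_subcoalgebra_grouplike:
  assumes "pointed sC \<Delta>" and "subcoalgebra sC \<Delta> D" "D \<noteq> {0}" and "finite S" "D \<subseteq> span S"
  shows "\<exists>g\<in>D. g \<in> grouplikes sC \<Delta> \<epsilon>"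
proof -
  obtain E where E: "E \<subseteq> D" "subcoalgebra sC \<Delta> E" "E \<noteq> {0}"
    "\<forall>N\<subseteq>E. subcoalgebra sC \<Delta> N \<and> N \<noteq> {0} \<longrightarrow> N = E"
    using minimal_subspace_exists[where P="\<lambda>E. subcoalgebra sC \<Delta> E \<and> E \<noteq> {0}", OF assms(4,5)]
      assms(2,3) by (auto simp: subcoalgebra_def)
  then have "simple_subcoalgebra sC \<Delta> E" unfolding simple_subcoalgebra_def by blast
  then have "dim E = 1" using assms(1) by (simp add: pointed_def)
  from subcoalgebra_grouplike_of_dim_1[OF E(2) this] E(1) show ?thesis by blast
qed

end

section \<open>The action of functionals on a comodule and its matrix coefficients\<close>

context left_comodule
begin

interpretation CV: vector_space_pair sC sV ..
interpretation CC: vector_space_pair sC sC ..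

text \<open>This makes the comodule a right module over the convolution algebra of
  functionals.\<close>

definition act :: "('c \<Rightarrow> 'k) \<Rightarrow> 'v \<Rightarrow> 'v" where
  "act f v = lslice sC sV f (\<rho> v)"

text \<open>For coordinate functionals \<open>\<phi>\<close> and basis vectors \<open>v\<close>
  these are the matrix coefficients of the comodule.\<close>

definition coef :: "('v \<Rightarrow> 'k) \<Rightarrow> 'v \<Rightarrow> 'c" where
  "coef \<phi> v = rslice sC sV \<phi> (\<rho> v)"

lemma coaction_obtain:
  obtains n :: nat and x y where "\<rho> v = (\<Sum>i<n. tens sC sV (x i) (y i))"
  by (rule CV.tensor_span_obtain[OF coaction_tensor subspace_UNIV]) (rule that)

lemma comult_obtain:
  obtains n :: nat and x y where "\<Delta> c = (\<Sum>i<n. tens sC sC (x i) (y i))"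
  by (rule CC.tensor_span_obtain[OF comult_tensor subspace_UNIV]) (rule that)

lemma linear_act: "functional sC f \<Longrightarrow> Vector_Spaces.linear sV sV (act f)"
  unfolding act_def by (rule linear_compose'[OF coaction_linear CV.linear_lslice])

lemma linear_coef: "functional sV \<phi> \<Longrightarrow> Vector_Spaces.linear sV sC (coef \<phi>)"
  unfolding coef_def by (rule linear_compose'[OF coaction_linear CV.linear_rslice])

lemma act_sum:
  assumes "functional sC f" and "\<rho> v = (\<Sum>i\<in>I. tens sC sV (x i) (y i))"
  shows "act f v = (\<Sum>i\<in>I. sV (f (x i)) (y i))"
  unfolding act_def assms(2) by (rule CV.lslice_sum[OF assms(1)])

lemma coef_sum:
  assumes "functional sV \<phi>" and "\<rho> v = (\<Sum>i\<in>I. tens sC sV (x i) (y i))"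
  shows "coef \<phi> v = (\<Sum>i\<in>I. sC (\<phi> (y i)) (x i))"
  unfolding coef_def assms(2) by (rule CV.rslice_sum[OF assms(1)])

lemma act_counit: "act \<epsilon> v = v"
  unfolding act_def lslice_def by (rule coaction_counit)

text \<open>Both sides are \<open>f \<otimes> \<phi>\<close> applied to \<open>\<rho> v\<close>.
  Identities for \<open>act\<close> can thus be tested on coefficients.\<close>

lemma functional_act:
  assumes "functional sC f" "functional sV \<phi>"
  shows "\<phi> (act f v) = f (coef \<phi> v)"
proof -
  obtain n x y where xy: "\<rho> v = (\<Sum>i<n::nat. tens sC sV (x i) (y i))" by (rule coaction_obtain)
  show ?thesis
    unfolding act_sum[OF assms(1) xy] coef_sum[OF assms(2) xy]
    by (simp add: linear_sum'[OF assms(1)] linear_sum'[OF assms(2)] linear_scale'[OF assms(1)]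
        linear_scale'[OF assms(2)] mult.commute)
qed

text \<open>The map \<open>coef \<phi>\<close> is a comodule map: apply \<open>id \<otimes> id \<otimes> \<phi>\<close> to the coassociativity law.\<close>

lemma comult_coef:
  assumes \<phi>: "functional sV \<phi>" and v: "\<rho> v = (\<Sum>i<n::nat. tens sC sV (x i) (y i))"
  shows "\<Delta> (coef \<phi> v) = (\<Sum>i<n. tens sC sC (x i) (coef \<phi> (y i)))"
proof -
  interpret T: vector_space "tscale :: 'k \<Rightarrow> ('k, 'c, 'v) tensor \<Rightarrow> _" by (rule vector_space_tscale)
  interpret T2: vector_space "tscale :: 'k \<Rightarrow> ('k, 'c, 'c) tensor \<Rightarrow> _" by (rule vector_space_tscale)
  interpret T3: vector_space "tscale :: 'k \<Rightarrow> ('k, 'c, ('k, 'c, 'v) tensor) tensor \<Rightarrow> _"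
    by (rule vector_space_tscale)
  interpret CT: vector_space_pair sC "tscale :: 'k \<Rightarrow> ('k, 'c, 'v) tensor \<Rightarrow> _" ..
  \<comment> \<open>\<open>M\<close> is \<open>id \<otimes> id \<otimes> \<phi>\<close> in the
    bracketing C \<otimes> (C \<otimes> V) of the coassociativity law.\<close>
  define M where "M = tensor_lift sC tscale tscale (\<lambda>c t. tens sC sC c (rslice sC sV \<phi> t))"
  note tb = bilinear_add_left[OF CC.bilinear_tens'] bilinear_add_right[OF CC.bilinear_tens']
    bilinear_scale_left[OF CC.bilinear_tens'] bilinear_scale_right[OF CC.bilinear_tens']
    bilinear_add_left[OF CV.bilinear_tens'] bilinear_add_right[OF CV.bilinear_tens']
    bilinear_scale_left[OF CV.bilinear_tens'] bilinear_scale_right[OF CV.bilinear_tens']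
    bilinear_add_left[OF CT.bilinear_tens'] bilinear_add_right[OF CT.bilinear_tens']
    bilinear_scale_left[OF CT.bilinear_tens'] bilinear_scale_right[OF CT.bilinear_tens']
  note vs = vector_space_axioms V.vector_space_axioms vector_space_tscale
  have BM: "bilinear_map sC tscale tscale (\<lambda>c t. tens sC sC c (rslice sC sV \<phi> t))"
    unfolding bilinear_map_def Vector_Spaces.linear_iff
    by (auto simp: vs tb linear_add'[OF CV.linear_rslice[OF \<phi>]]
        linear_scale'[OF CV.linear_rslice[OF \<phi>]])
  have linM: "Vector_Spaces.linear tscale tscale M"
    unfolding M_def by (rule linear_tensor_lift[OF vector_space_tscale BM])
  have M: "M (tens sC tscale c t) = tens sC sC c (rslice sC sV \<phi> t)" for c t
    unfolding M_def by (rule tensor_lift_tens[OF vector_space_tscale BM])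
  have B0: "bilinear_map sC sC tscale (\<lambda>c1 c2. tens sC tscale c1 (tens sC sV c2 w))" for w
    unfolding bilinear_map_def Vector_Spaces.linear_iff by (auto simp: vs tb)
  \<comment> \<open>\<open>G c w\<close> is \<Delta> c \<otimes> w after reassociation, the function
    lifted on the left of the coassociativity law.\<close>
  define G where "G c w = tensor_lift sC sC tscale
      (\<lambda>c1 c2. tens sC tscale c1 (tens sC sV c2 w)) (\<Delta> c)" for c w
  have G: "G c w = (\<Sum>j<m. tens sC tscale (a j) (tens sC sV (b j) w))"
    if "\<Delta> c = (\<Sum>j<m::nat. tens sC sC (a j) (b j))" for c w m a b
    unfolding G_def that by (rule CC.tensor_lift_sum[OF vector_space_tscale B0])
  have linGl: "Vector_Spaces.linear sC tscale (\<lambda>c. G c w)" for w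
    unfolding G_def
    by (rule linear_compose'[OF comult_linear linear_tensor_lift[OF vector_space_tscale B0]])
  \<comment> \<open>Linearity in \<open>w\<close> is hidden inside \<open>tensor_lift\<close>, so
    \<open>\<Delta> c\<close> is first written as a sum of pure tensors.\<close>
  have linGr: "Vector_Spaces.linear sV tscale (G c)" for c
  proof -
    obtain m a b where c: "\<Delta> c = (\<Sum>j<m::nat. tens sC sC (a j) (b j))" by (rule comult_obtain)
    show ?thesis unfolding Vector_Spaces.linear_iff G[OF c]
      by (simp add: vs tb sum.distrib T3.scale_sum_right)
  qed
  have B1: "bilinear_map sC sV tscale G"
    unfolding bilinear_map_def using linGl linGr by blast
  have B2: "bilinear_map sC sV tscale (\<lambda>c w. tens sC tscale c (\<rho> w))"
    unfolding bilinear_map_def Vector_Spaces.linear_iff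
    by (auto simp: vs tb linear_add'[OF coaction_linear] linear_scale'[OF coaction_linear])
  have MG: "M (G c w) = tscale (\<phi> w) (\<Delta> c)" for c w
  proof -
    obtain m a b where c: "\<Delta> c = (\<Sum>j<m::nat. tens sC sC (a j) (b j))" by (rule comult_obtain)
    show ?thesis unfolding G[OF c] c linear_sum'[OF linM] M
      by (simp add: CV.rslice_tens[OF \<phi>] tb T2.scale_sum_right)
  qed
  have "tensor_lift sC sV tscale G (\<rho> v) = tensor_lift sC sV tscale (\<lambda>c w. tens sC tscale c (\<rho> w)) (\<rho> v)"
    using coaction_coassoc unfolding coassociative_def G_def by simp
  then have "(\<Sum>i<n. G (x i) (y i)) = (\<Sum>i<n. tens sC tscale (x i) (\<rho> (y i)))"
    unfolding v CV.tensor_lift_sum[OF vector_space_tscale B1]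
      CV.tensor_lift_sum[OF vector_space_tscale B2] .
  then have "M (\<Sum>i<n. G (x i) (y i)) = M (\<Sum>i<n. tens sC tscale (x i) (\<rho> (y i)))" by simp
  then have "(\<Sum>i<n. tscale (\<phi> (y i)) (\<Delta> (x i))) = (\<Sum>i<n. tens sC sC (x i) (coef \<phi> (y i)))"
    unfolding linear_sum'[OF linM] MG M coef_def .
  then show ?thesis
    unfolding coef_sum[OF \<phi> v] by (simp add: linear_sum'[OF comult_linear] linear_scale'[OF comult_linear])
qed

text \<open>Apply \<open>f\<close> to the left factors in \<open>comult_coef\<close>. Since
  contracting \<open>\<Delta>\<close> is the action of \<open>f\<close> on the coalgebra itself,
  this says that \<open>coef \<phi>\<close> is equivariant.\<close>

lemma lslice_comult_coef:
  assumes f: "functional sC f" and \<phi>: "functional sV \<phi>"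
  shows "lslice sC sC f (\<Delta> (coef \<phi> v)) = coef \<phi> (act f v)"
proof -
  obtain n x y where xy: "\<rho> v = (\<Sum>i<n::nat. tens sC sV (x i) (y i))" by (rule coaction_obtain)
  show ?thesis
    unfolding comult_coef[OF \<phi> xy] CC.lslice_sum[OF f] act_sum[OF f xy]
    by (simp add: linear_sum'[OF linear_coef[OF \<phi>]] linear_scale'[OF linear_coef[OF \<phi>]])
qed

lemma linear_lslice_comult:
  "functional sC f \<Longrightarrow> Vector_Spaces.linear sC sC (\<lambda>c. lslice sC sC f (\<Delta> c))"
  by (rule linear_compose'[OF comult_linear CC.linear_lslice])

text \<open>The witness is the convolution product of \<open>f'\<close> and \<open>f\<close>, in
  this order; equality is tested on functionals, where it reduces to
  \<open>lslice_comult_coef\<close>.\<close>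

lemma act_act:
  assumes "functional sC f" "functional sC f'"
  shows "\<exists>h. functional sC h \<and> (\<forall>v. act f (act f' v) = act h v)"
proof (intro exI conjI allI)
  define h where "h c = f (lslice sC sC f' (\<Delta> c))" for c
  show h: "functional sC h"
    unfolding h_def by (rule linear_compose'[OF linear_lslice_comult[OF assms(2)] assms(1)])
  show "act f (act f' v) = act h v" for v
  proof (rule functional_ext[OF V.vector_space_axioms])
    fix \<phi> assume \<phi>: "functional sV \<phi>"
    show "\<phi> (act f (act f' v)) = \<phi> (act h v)"
      unfolding functional_act[OF assms(1) \<phi>] functional_act[OF h \<phi>]
      unfolding h_def lslice_comult_coef[OF assms(2) \<phi>] ..
  qed
qed

text \<open>The values \<open>act f w\<close> are the left slices of \<open>\<rho> w\<close>, and
  these all lie in \<open>W\<close> exactly when \<open>\<rho> w\<close> lies in C \<otimes>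
  W.\<close>

lemma subcomodule_iff:
  "subcomodule sC sV \<rho> W \<longleftrightarrow> V.subspace W \<and> (\<forall>f. functional sC f \<longrightarrow> (\<forall>w\<in>W. act f w \<in> W))"
proof -
  have "\<rho> w \<in> tensor_span sC sV UNIV W \<longleftrightarrow> (\<forall>f. functional sC f \<longrightarrow> act f w \<in> W)"
    if W: "V.subspace W" for w
    using CV.lslice_tensor_span[OF _ W, of _ "\<rho> w"]
      CV.tensor_span_right_slices[OF subspace_UNIV W coaction_tensor[of w]]
    unfolding act_def by blast
  then show ?thesis unfolding subcomodule_def by blast
qed

text \<open>The witness is the cyclic module generated by \<open>v\<close>. It contains
  \<open>v\<close> because \<open>\<epsilon>\<close> acts as the identity, and it lies in the span
  of the finitely many right factors of \<open>\<rho> v\<close>.\<close>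

lemma finite_subcomodule_containing:
  assumes "subcomodule sC sV \<rho> U" "v \<in> U"
  shows "\<exists>W S. subcomodule sC sV \<rho> W \<and> v \<in> W \<and> W \<subseteq> U \<and> finite S \<and> W \<subseteq> V.span S"
proof -
  obtain n x y where xy: "\<rho> v = (\<Sum>i<n::nat. tens sC sV (x i) (y i))" by (rule coaction_obtain)
  let ?W = "{act f v | f. functional sC f}"
  have v: "v \<in> ?W" using act_counit[of v] counit_linear by (metis (mono_tags, lifting) mem_Collect_eq)
  have WU: "?W \<subseteq> U" using assms unfolding subcomodule_iff by auto
  have WS: "?W \<subseteq> V.span (y ` {..<n})"
    using act_sum[OF _ xy] by (auto intro!: V.span_sum V.span_scale V.span_base[OF imageI])
  have "V.subspace ?W"
  proof (rule V.subspaceI)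
    have z: "functional sC (\<lambda>_. 0)"
      using vector_space_axioms vector_space_field_mult by (simp add: Vector_Spaces.linear_iff)
    have "act (\<lambda>_. 0) v = 0" by (simp add: act_sum[OF z xy])
    then show "0 \<in> ?W" using z by (metis (mono_tags, lifting) mem_Collect_eq)
  next
    fix a b assume "a \<in> ?W" "b \<in> ?W"
    then obtain f g where fg: "functional sC f" "a = act f v" "functional sC g" "b = act g v" by blast
    have h: "functional sC (\<lambda>c. f c + g c)"
      using fg(1,3) by (simp add: Vector_Spaces.linear_iff algebra_simps)
    have "a + b = act (\<lambda>c. f c + g c) v"
      unfolding fg(2,4) act_sum[OF fg(1) xy] act_sum[OF fg(3) xy] act_sum[OF h xy]
      by (simp add: sum.distrib V.scale_left_distrib)
    then show "a + b \<in> ?W" using h by blast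
  next
    fix k a assume "a \<in> ?W"
    then obtain f where f: "functional sC f" "a = act f v" by blast
    have h: "functional sC (\<lambda>c. k * f c)"
      using f(1) by (simp add: Vector_Spaces.linear_iff algebra_simps)
    have "sV k a = act (\<lambda>c. k * f c) v"
      unfolding f(2) act_sum[OF f(1) xy] act_sum[OF h xy] by (simp add: V.scale_sum_right)
    then show "sV k a \<in> ?W" using h by blast
  qed
  moreover have "act f w \<in> ?W" if "functional sC f" "w \<in> ?W" for f w
    using that act_act by blast
  ultimately have "subcomodule sC sV \<rho> ?W" unfolding subcomodule_iff by blast
  with v WU WS show ?thesis by (intro exI[of _ ?W] exI[of _ "y ` {..<n}"]) simp
qed

text \<open>With all functionals this is the coefficient coalgebra of \<open>W\<close>. The set
  \<open>\<Phi>\<close> is a parameter because a smallest one is later chosen for a single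
  element.\<close>

definition coef_space :: "('v \<Rightarrow> 'k) set \<Rightarrow> 'v set \<Rightarrow> 'c set" where
  "coef_space \<Phi> W = span {coef \<phi> w | \<phi> w. \<phi> \<in> \<Phi> \<and> w \<in> W}"

lemma coef_in_coef_space: "\<phi> \<in> \<Phi> \<Longrightarrow> w \<in> W \<Longrightarrow> coef \<phi> w \<in> coef_space \<Phi> W"
  unfolding coef_space_def by (auto intro: span_base)

lemma subspace_coef_space: "subspace (coef_space \<Phi> W)"
  unfolding coef_space_def by simp

text \<open>The right slices of \<open>\<rho> w\<close> are coefficients, so \<open>\<rho> w\<close>
  lies in D \<otimes> W with D the coefficient space. Such an expansion, put into
  \<open>comult_coef\<close>, has both factors of the coproduct in D.\<close>

lemma coef_space_subcoalgebra:
  assumes W: "subcomodule sC sV \<rho> W"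
  shows "subcoalgebra sC \<Delta> (coef_space (Collect (functional sV)) W)"
proof -
  let ?D = "coef_space (Collect (functional sV)) W"
  have subW: "V.subspace W" using W by (simp add: subcomodule_def)
  interpret T: vector_space "tscale :: 'k \<Rightarrow> ('k, 'c, 'c) tensor \<Rightarrow> _" by (rule vector_space_tscale)
  have gen: "\<Delta> (coef \<phi> w) \<in> tensor_span sC sC ?D ?D" if \<phi>: "functional sV \<phi>" and w: "w \<in> W" for \<phi> w
  proof -
    have "\<rho> w \<in> tensor_span sC sV UNIV W" using W w by (auto simp: subcomodule_def)
    then have "\<rho> w \<in> tensor_span sC sV ?D W"
      by (rule CV.tensor_span_left_slices[OF subspace_coef_space subW])
        (use w coef_in_coef_space in \<open>auto simp: coef_def\<close>)
    then obtain n x y where xy: "\<And>i. i < n \<Longrightarrow> x i \<in> ?D" "\<And>i. i < n \<Longrightarrow> y i \<in> W"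
      "\<rho> w = (\<Sum>i<n::nat. tens sC sV (x i) (y i))"
      using CV.tensor_span_obtain[OF _ subspace_coef_space] by blast
    show ?thesis unfolding comult_coef[OF \<phi> xy(3)]
      using xy(1,2) \<phi> by (intro CC.tensor_span_sum coef_in_coef_space) auto
  qed
  have "\<Delta> d \<in> tensor_span sC sC ?D ?D" if "d \<in> ?D" for d
    using that unfolding coef_space_def[of "Collect (functional sV)" W]
  proof (induction rule: span_induct_alt)
    case base
    show ?case unfolding linear_0'[OF comult_linear] tensor_span_def by (rule T.span_zero)
  next
    case (step k c d)
    then have "\<Delta> c \<in> tensor_span sC sC ?D ?D" using gen by blast
    moreover have "\<Delta> d \<in> tensor_span sC sC ?D ?D" using step unfolding coef_space_def by blast
    ultimately have "\<Delta> (sC k c + d) \<in> tensor_span sC sC ?D ?D"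
      unfolding linear_add'[OF comult_linear] linear_scale'[OF comult_linear] tensor_span_def
      by (intro T.span_add T.span_scale)
    then show ?case unfolding coef_space_def .
  qed
  then show ?thesis using subspace_coef_space by (auto simp: subcoalgebra_def)
qed

text \<open>The counit recovers the functional:
  \<open>\<epsilon> (coef \<phi> w) = \<phi> w\<close>.\<close>

lemma coef_space_nonzero:
  assumes "w \<in> W" "w \<noteq> 0"
  shows "coef_space (Collect (functional sV)) W \<noteq> {0}"
proof -
  obtain \<phi> where \<phi>: "functional sV \<phi>" "\<phi> w = 1"
    using functional_exists[OF V.vector_space_axioms assms(2)] .
  have "\<epsilon> (coef \<phi> w) = 1" using functional_act[OF counit_linear \<phi>(1), of w] \<phi>(2) act_counit by simp
  then have "coef \<phi> w \<noteq> 0" using linear_0'[OF counit_linear] by auto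
  then show ?thesis using coef_in_coef_space[of \<phi> "Collect (functional sV)" w W] \<phi>(1) assms(1) by auto
qed

text \<open>The left factors of one expansion of \<open>\<rho> s\<close> span the coefficients of
  \<open>s\<close> for all functionals at once; the union over \<open>s \<in> S\<close> spans the
  rest by linearity.\<close>

lemma coef_space_finite:
  assumes "finite S" "W \<subseteq> V.span S"
  shows "\<exists>R. finite R \<and> coef_space (Collect (functional sV)) W \<subseteq> span R"
proof -
  have "\<exists>R. finite R \<and> (\<forall>\<phi>. functional sV \<phi> \<longrightarrow> coef \<phi> s \<in> span R)" for s
  proof -
    obtain n x y where xy: "\<rho> s = (\<Sum>i<n::nat. tens sC sV (x i) (y i))" by (rule coaction_obtain)
    have "coef \<phi> s \<in> span (x ` {..<n})" if "functional sV \<phi>" for \<phi>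
      unfolding coef_sum[OF that xy] by (intro span_sum span_scale span_base) auto
    then show ?thesis by (intro exI[of _ "x ` {..<n}"]) auto
  qed
  then obtain R where R: "\<And>s. finite (R s)" "\<And>s \<phi>. functional sV \<phi> \<Longrightarrow> coef \<phi> s \<in> span (R s)"
    by metis
  let ?R = "\<Union>s\<in>S. R s"
  have "coef \<phi> w \<in> span ?R" if \<phi>: "functional sV \<phi>" and "w \<in> W" for \<phi> w
  proof -
    have "w \<in> V.span S" using that assms(2) by blast
    then show ?thesis
    proof (induction rule: V.span_induct_alt)
      case base
      then show ?case by (simp add: linear_0'[OF linear_coef[OF \<phi>]] span_zero)
    next
      case (step k s w)
      have "coef \<phi> s \<in> span ?R" using R(2)[OF \<phi>, of s] span_mono[of "R s" ?R] step(1) by blast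
      then show ?case
        using step by (simp add: linear_add'[OF linear_coef[OF \<phi>]] linear_scale'[OF linear_coef[OF \<phi>]]
            span_add span_scale)
    qed
  qed
  then have "coef_space (Collect (functional sV)) W \<subseteq> span ?R"
    unfolding coef_space_def by (intro span_minimal) auto
  moreover have "finite ?R" using assms(1) R(1) by blast
  ultimately show ?thesis by blast
qed

text \<open>Equivariance of \<open>coef \<phi>\<close> and stability of \<open>W\<close> make the
  coefficient space stable for any set of functionals; it is applied to a set with one functional
  removed.\<close>

lemma coef_space_lslice:
  assumes W: "subcomodule sC sV \<rho> W" and \<Phi>: "\<And>\<phi>. \<phi> \<in> \<Phi> \<Longrightarrow> functional sV \<phi>"
    and f: "functional sC f" and c: "c \<in> coef_space \<Phi> W"
  shows "lslice sC sC f (\<Delta> c) \<in> coef_space \<Phi> W"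
  using c unfolding coef_space_def
proof (induction rule: span_induct_alt)
  case base
  then show ?case by (simp add: linear_0'[OF linear_lslice_comult[OF f]] span_zero)
next
  case (step k c d)
  then obtain \<phi> w where c: "c = coef \<phi> w" "\<phi> \<in> \<Phi>" "w \<in> W" by blast
  have "act f w \<in> W" using W f c(3) by (auto simp: subcomodule_iff)
  then have "lslice sC sC f (\<Delta> c) \<in> span {coef \<phi> w | \<phi> w. \<phi> \<in> \<Phi> \<and> w \<in> W}"
    unfolding c(1) lslice_comult_coef[OF f \<Phi>[OF c(2)]] using c(2) by (auto intro: span_base)
  then show ?case
    using step by (simp add: linear_add'[OF linear_lslice_comult[OF f]]
        linear_scale'[OF linear_lslice_comult[OF f]] span_add span_scale)
qed

text \<open>For a simple comodule \<open>W\<close> the coefficient space is a sum of copies of \<open>W\<close>, so every line in it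
  that is a subcomodule is isomorphic to \<open>W\<close>. Writing \<open>g\<close> with as few copies as possible makes the
  component in one of them unique, hence of weight \<open>g\<close>.\<close>

lemma simple_comodule_weight:
  assumes W: "subcomodule sC sV \<rho> W"
    and min: "\<And>N. N \<subseteq> W \<Longrightarrow> subcomodule sC sV \<rho> N \<Longrightarrow> N \<noteq> {0} \<Longrightarrow> N = W"
    and g: "\<Delta> g = tens sC sC g g" "g \<noteq> 0" "g \<in> coef_space (Collect (functional sV)) W"
  shows "\<exists>u\<in>W. u \<noteq> 0 \<and> \<rho> u = tens sC sV g u"
proof -
  have subW: "V.subspace W" using W by (simp add: subcomodule_def)
  let ?P = "\<lambda>\<Phi>. finite \<Phi> \<and> \<Phi> \<subseteq> Collect (functional sV) \<and> g \<in> coef_space \<Phi> W"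
  \<comment> \<open>A finite combination of coefficients involves only finitely many
    functionals.\<close>
  have "\<exists>\<Phi>. ?P \<Phi>"
  proof -
    obtain I r where I: "finite I" "I \<subseteq> {coef \<phi> w | \<phi> w. \<phi> \<in> Collect (functional sV) \<and> w \<in> W}"
      "g = (\<Sum>a\<in>I. sC (r a) a)"
      using g(3) unfolding coef_space_def span_explicit by blast
    have "\<forall>a\<in>I. \<exists>\<phi> w. a = coef \<phi> w \<and> functional sV \<phi> \<and> w \<in> W" using I(2) by blast
    then obtain \<phi> w where pw: "\<And>a. a \<in> I \<Longrightarrow> a = coef (\<phi> a) (w a) \<and> functional sV (\<phi> a) \<and> w a \<in> W"
      by metis
    have "a \<in> coef_space (\<phi> ` I) W" if "a \<in> I" for a
      using pw[OF that] coef_in_coef_space[of "\<phi> a" "\<phi> ` I" "w a" W] that by simp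
    then have "g \<in> coef_space (\<phi> ` I) W"
      unfolding I(3) by (intro subspace_sum subspace_scale subspace_coef_space)
    then show ?thesis using I(1) pw by (intro exI[of _ "\<phi> ` I"]) auto
  qed
  then obtain \<Phi> where \<Phi>: "?P \<Phi>" and least: "\<And>\<Psi>. ?P \<Psi> \<Longrightarrow> card \<Phi> \<le> card \<Psi>"
    using ex_has_least_nat[of ?P _ card] by metis
  have "\<Phi> \<noteq> {}" using \<Phi> g(2) by (auto simp: coef_space_def)
  then obtain \<phi> where \<phi>: "\<phi> \<in> \<Phi>" by blast
  \<comment> \<open>\<open>X\<close> is the contribution of the other copies; minimality of
    \<open>\<Phi>\<close> keeps \<open>g\<close> out of it.\<close>
  define X where "X = coef_space (\<Phi> - {\<phi>}) W"
  have gX: "g \<notin> X"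
    using least[of "\<Phi> - {\<phi>}"] \<Phi> \<phi> card_Diff1_less[of \<Phi> \<phi>] unfolding X_def by fastforce
  have subX: "subspace X" unfolding X_def by (rule subspace_coef_space)
  have lin: "functional sV \<phi>" using \<phi> \<Phi> by blast
  note lc = linear_coef[OF lin]
  have sliceX: "lslice sC sC f (\<Delta> c) \<in> X" if "functional sC f" "c \<in> X" for f c
    using coef_space_lslice[OF W _ that(1), of "\<Phi> - {\<phi>}" c] that(2) \<Phi> unfolding X_def by blast
  \<comment> \<open>Modulo \<open>X\<close> only coefficients of \<open>\<phi>\<close> survive, and
    by linearity they combine into a single \<open>coef \<phi> u\<close>.\<close>
  have decomp: "\<exists>u\<in>W. c - coef \<phi> u \<in> X" if "c \<in> coef_space \<Phi> W" for c
    using that unfolding coef_space_def[of \<Phi>]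
  proof (induction rule: span_induct_alt)
    case base
    then show ?case
      using V.subspace_0[OF subW] linear_0'[OF lc] subspace_0[OF subX] by (intro bexI[of _ 0]) auto
  next
    case (step k c d)
    then obtain u where u: "u \<in> W" "d - coef \<phi> u \<in> X" by blast
    obtain \<psi> w where c: "c = coef \<psi> w" "\<psi> \<in> \<Phi>" "w \<in> W" using step(1) by blast
    show ?case
    proof (cases "\<psi> = \<phi>")
      case True
      then have eq: "sC k c + d - coef \<phi> (sV k w + u) = d - coef \<phi> u"
        by (simp add: c(1) linear_add'[OF lc] linear_scale'[OF lc])
      have "sV k w + u \<in> W"
        using u(1) c(3) subW by (intro V.subspace_add V.subspace_scale)
      moreover have "sC k c + d - coef \<phi> (sV k w + u) \<in> X" unfolding eq by (rule u(2))
      ultimately show ?thesis by blast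
    next
      case False
      then have "c \<in> X" using c unfolding X_def by (auto intro: coef_in_coef_space)
      then have "sC k c + (d - coef \<phi> u) \<in> X" using u(2) subX by (intro subspace_add subspace_scale)
      then show ?thesis using u(1) by (intro bexI[of _ u]) (auto simp: algebra_simps)
    qed
  qed
  \<comment> \<open>\<open>N\<close> is the kernel of \<open>coef \<phi>\<close> modulo
    \<open>X\<close>. If it were all of \<open>W\<close>, then \<open>g\<close> would lie in
    \<open>X\<close>; so it is zero by minimality of \<open>W\<close>, and elements of
    \<open>W\<close> can be compared modulo \<open>X\<close>.\<close>
  define N where "N = {u \<in> W. coef \<phi> u \<in> X}"
  have "subcomodule sC sV \<rho> N"
    unfolding subcomodule_iff
  proof (intro conjI allI impI ballI)
    show "V.subspace N"
      using subW subX unfolding N_def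
      by (intro V.subspaceI) (auto simp: linear_0'[OF lc] linear_add'[OF lc] linear_scale'[OF lc]
          V.subspace_0 V.subspace_add V.subspace_scale subspace_0 subspace_add subspace_scale)
    show "act f u \<in> N" if "functional sC f" "u \<in> N" for f u
      using that W sliceX[OF that(1), of "coef \<phi> u"]
      unfolding N_def subcomodule_iff lslice_comult_coef[OF that(1) lin] by auto
  qed
  moreover have "N \<noteq> W"
  proof
    assume "N = W"
    obtain u where "u \<in> W" "g - coef \<phi> u \<in> X" using decomp \<Phi> by blast
    then have "g - coef \<phi> u + coef \<phi> u \<in> X"
      using \<open>N = W\<close> subspace_add[OF subX] unfolding N_def by blast
    then show False using gX by simp
  qed
  ultimately have N0: "N = {0}" using min[of N] unfolding N_def by blast
  obtain u where u: "u \<in> W" "g - coef \<phi> u \<in> X" using decomp \<Phi> by blast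
  \<comment> \<open>Modulo \<open>X\<close>, \<open>coef \<phi> u\<close> equals \<open>g\<close>,
    on which \<open>f\<close> acts by the scalar \<open>f g\<close>; since \<open>N\<close> is zero,
    the same holds for \<open>u\<close>.\<close>
  have act: "act f u = sV (f g) u" if f: "functional sC f" for f
  proof -
    let ?L = "\<lambda>c. lslice sC sC f (\<Delta> c)"
    note lL = linear_lslice_comult[OF f]
    have "?L g = sC (f g) g" unfolding g(1) by (rule CC.lslice_tens[OF f])
    then have "coef \<phi> (act f u - sV (f g) u) = sC (f g) (g - coef \<phi> u) - ?L (g - coef \<phi> u)"
      by (simp add: linear_diff'[OF lc] linear_scale'[OF lc] linear_diff'[OF lL]
          lslice_comult_coef[OF f lin] scale_right_diff_distrib)
    also have "\<dots> \<in> X"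
      by (rule subspace_diff[OF subX subspace_scale[OF subX u(2)] sliceX[OF f u(2)]])
    finally have "act f u - sV (f g) u \<in> N"
      using u(1) W f subW unfolding N_def subcomodule_iff
      by (auto intro: V.subspace_diff V.subspace_scale)
    then show ?thesis using N0 by simp
  qed
  have "tens sC sV g u \<in> tensor_space sC sV"
    using CV.tensor_span_sum[of "{()}" "\<lambda>_. g" UNIV "\<lambda>_. u" UNIV] by simp
  then have "\<rho> u = tens sC sV g u"
    using act coaction_tensor CV.lslice_tens unfolding act_def by (intro CV.tensor_eqI) auto
  moreover have "u \<noteq> 0" using u(2) gX linear_0'[OF lc] by auto
  ultimately show ?thesis using u(1) by blast
qed

theorem pointed_subcomodule_weight:
  assumes pointed: "pointed sC \<Delta>" and U: "subcomodule sC sV \<rho> U" "U \<noteq> {0}"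
  shows "\<exists>g\<in>grouplikes sC \<Delta> \<epsilon>. \<exists>u\<in>U. u \<noteq> 0 \<and> \<rho> u = tens sC sV g u"
proof -
  have "0 \<in> U" using U(1) V.subspace_0 by (auto simp: subcomodule_def)
  then obtain v where v: "v \<in> U" "v \<noteq> 0" using U(2) by blast
  \<comment> \<open>Minimal subobjects are obtained below a finite spanning set, hence the passage
    to a finite-dimensional subcomodule containing \<open>v\<close>.\<close>
  obtain W0 S where W0: "subcomodule sC sV \<rho> W0" "v \<in> W0" "W0 \<subseteq> U" "finite S" "W0 \<subseteq> V.span S"
    using finite_subcomodule_containing[OF U(1) v(1)] by blast
  have "W0 \<noteq> {0}" using W0(2) v(2) by auto
  moreover have "V.subspace N" if "subcomodule sC sV \<rho> N \<and> N \<noteq> {0}" for N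
    using that by (simp add: subcomodule_def)
  ultimately obtain W where W: "W \<subseteq> W0" "subcomodule sC sV \<rho> W" "W \<noteq> {0}"
    "\<forall>N\<subseteq>W. subcomodule sC sV \<rho> N \<and> N \<noteq> {0} \<longrightarrow> N = W"
    using V.minimal_subspace_exists[where P="\<lambda>N. subcomodule sC sV \<rho> N \<and> N \<noteq> {0}", OF W0(4,5)]
      W0(1) by (elim exE conjE meta_impE) auto
  let ?D = "coef_space (Collect (functional sV)) W"
  have "0 \<in> W" using W(2) V.subspace_0 by (auto simp: subcomodule_def)
  then obtain w where "w \<in> W" "w \<noteq> 0" using W(3) by blast
  then have "?D \<noteq> {0}" by (rule coef_space_nonzero)
  moreover have "W \<subseteq> V.span S" using W(1) W0(5) by blast
  then obtain R where "finite R" "?D \<subseteq> span R" using coef_space_finite[OF W0(4)] by blast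
  ultimately obtain g where g: "g \<in> ?D" "g \<in> grouplikes sC \<Delta> \<epsilon>"
    using pointed_subcoalgebra_grouplike[OF pointed coef_space_subcoalgebra[OF W(2)]] by blast
  have "\<Delta> g = tens sC sC g g" "g \<noteq> 0"
    using g(2) linear_0'[OF counit_linear] by (auto simp: grouplikes_def)
  from simple_comodule_weight[OF W(2) _ this g(1)] W(4)
  have "\<exists>u\<in>W. u \<noteq> 0 \<and> \<rho> u = tens sC sV g u" by blast
  then show ?thesis using g(2) W(1) W0(3) by blast
qed

end

section \<open>Comodule algebras\<close>

lemma invertible_mem_left_ideal: "left_ideal I \<Longrightarrow> invertible_elem u \<Longrightarrow> u \<in> I \<Longrightarrow> I = UNIV"
  unfolding left_ideal_def invertible_elem_def by (metis UNIV_eq_I mult_1_right)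

lemma invertible_mem_right_ideal: "right_ideal I \<Longrightarrow> invertible_elem u \<Longrightarrow> u \<in> I \<Longrightarrow> I = UNIV"
  unfolding right_ideal_def invertible_elem_def by (metis UNIV_eq_I mult_1_left)

section \<open>Multiplication by homogeneous elements and one-sided ideals\<close>

context left_comodule_algebra
begin

interpretation HA: vector_space_pair sH sA ..

lemma functional_mult:
  assumes "functional sH f"
  shows "functional sH (\<lambda>x. f (g * x))" "functional sH (\<lambda>x. f (x * g))"
  using assms
  by (simp_all add: Vector_Spaces.linear_iff distrib_left distrib_right scale_mult_left
      scale_mult_right)

text \<open>The two nested lifts in \<open>tensor_mult\<close> are evaluated in turn, the inner one
  on the expansion of \<open>\<rho> b\<close>, the outer one on that of
  \<open>\<rho> a\<close>.\<close>

lemma coaction_mult_sum: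
  assumes "\<rho> a = (\<Sum>i\<in>I. tens sH sA (x i) (y i))" "\<rho> b = (\<Sum>j\<in>J. tens sH sA (z j) (w j))"
  shows "\<rho> (a * b) = (\<Sum>i\<in>I. \<Sum>j\<in>J. tens sH sA (x i * z j) (y i * w j))"
proof -
  have tb: "bilinear_map sH sA tscale (tens sH sA)" by (rule HA.bilinear_tens')
  note vs = vector_space_axioms A.vector_space_axioms vector_space_tscale
  have B: "bilinear_map sH sA tscale (\<lambda>x' y'. tens sH sA (x * x') (y * y'))" for x y
    by (simp add: bilinear_map_def Vector_Spaces.linear_iff vs distrib_left scale_mult_right
        A.scale_mult_right bilinear_add_left[OF tb] bilinear_add_right[OF tb]
        bilinear_scale_left[OF tb] bilinear_scale_right[OF tb])
  have in_b: "tensor_lift sH sA tscale (\<lambda>x' y'. tens sH sA (x * x') (y * y')) (\<rho> b) =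
      (\<Sum>j\<in>J. tens sH sA (x * z j) (y * w j))" for x y
    unfolding assms(2) by (rule HA.tensor_lift_sum[OF vector_space_tscale B])
  interpret T: vector_space "tscale :: 'k \<Rightarrow> ('k, 'h, 'a) tensor \<Rightarrow> _" by (rule vector_space_tscale)
  have B': "bilinear_map sH sA tscale (\<lambda>x y. \<Sum>j\<in>J. tens sH sA (x * z j) (y * w j))"
    by (simp add: bilinear_map_def Vector_Spaces.linear_iff vs distrib_right scale_mult_left
        A.scale_mult_left bilinear_add_left[OF tb] bilinear_add_right[OF tb]
        bilinear_scale_left[OF tb] bilinear_scale_right[OF tb] sum.distrib T.scale_sum_right)
  show ?thesis
    unfolding coaction_mult tensor_mult_def in_b assms(1)
    by (rule HA.tensor_lift_sum[OF vector_space_tscale B'])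
qed

text \<open>The degree \<open>g\<close> multiplies the left factors of \<open>\<rho> b\<close>, so
  it can be moved into the functional as a translation. Hence the one-sided ideals generated by
  \<open>a\<close> are stable under every \<open>act f\<close>.\<close>

lemma act_mult_homogeneous:
  assumes f: "functional sH f" and a: "\<rho> a = tens sH sA g a"
  shows "act f (b * a) = act (\<lambda>x. f (x * g)) b * a"
    and "act f (a * b) = a * act (\<lambda>x. f (g * x)) b"
proof -
  have a1: "\<rho> a = (\<Sum>j\<in>{()}. tens sH sA g a)" using a by simp
  obtain n x y where b: "\<rho> b = (\<Sum>i<n::nat. tens sH sA (x i) (y i))" by (rule coaction_obtain)
  have ba: "\<rho> (b * a) = (\<Sum>i<n. tens sH sA (x i * g) (y i * a))"
    using coaction_mult_sum[OF b a1] by simp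
  have ab: "\<rho> (a * b) = (\<Sum>i<n. tens sH sA (g * x i) (a * y i))"
    using coaction_mult_sum[OF a1 b] by simp
  show "act f (b * a) = act (\<lambda>x. f (x * g)) b * a"
    unfolding act_sum[OF f ba] act_sum[OF functional_mult(2)[OF f] b]
    by (simp add: sum_distrib_right A.scale_mult_left)
  show "act f (a * b) = a * act (\<lambda>x. f (g * x)) b"
    unfolding act_sum[OF f ab] act_sum[OF functional_mult(1)[OF f] b]
    by (simp add: sum_distrib_left A.scale_mult_right)
qed

text \<open>The degree gets a right inverse because multiplying by \<open>a\<close> on the right
  translates functionals on the right, and the annihilator argument has to undo this.\<close>

lemma left_H_simple_homogeneous_invertible:
  assumes simple: "left_H_simple sH sA \<rho>" and a: "\<rho> a = tens sH sA g a" "a \<noteq> 0"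
    and g': "g * g' = 1"
  shows "invertible_elem a"
proof -
  let ?I = "{b * a | b. True}" and ?N = "{b. b * a = 0}"
  have "left_ideal ?I"
    unfolding left_ideal_def
  proof (intro conjI ballI allI)
    show "0 \<in> ?I" by (auto intro: exI[of _ 0])
    show "x + y \<in> ?I" if "x \<in> ?I" "y \<in> ?I" for x y
      using that by (auto simp: distrib_right[symmetric])
    show "c * x \<in> ?I" if "x \<in> ?I" for c x
      using that by (auto simp: mult.assoc[symmetric])
  qed
  moreover have "subcomodule sH sA \<rho> ?I"
    unfolding subcomodule_iff
  proof (intro conjI allI impI ballI)
    show "A.subspace ?I"
    proof (rule A.subspaceI)
      show "0 \<in> ?I" by (auto intro: exI[of _ 0])
      show "x + y \<in> ?I" if "x \<in> ?I" "y \<in> ?I" for x y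
        using that by (auto simp: distrib_right[symmetric])
      show "sA c x \<in> ?I" if "x \<in> ?I" for c x
        using that by (auto simp: A.scale_mult_left[symmetric])
    qed
    show "act f x \<in> ?I" if "functional sH f" "x \<in> ?I" for f x
      using that act_mult_homogeneous(1)[OF that(1) a(1)] by auto
  qed
  moreover have "a \<in> ?I" by (intro CollectI exI[of _ 1]) simp
  then have "?I \<noteq> {0}" using a(2) by (metis singletonD)
  ultimately have "?I = UNIV" using simple unfolding left_H_simple_def by blast
  then have "1 \<in> ?I" by (simp only: UNIV_I)
  then obtain b where b: "b * a = 1" by auto
  have "left_ideal ?N" unfolding left_ideal_def by (auto simp: distrib_right mult.assoc)
  moreover have "subcomodule sH sA \<rho> ?N"
    unfolding subcomodule_iff
  proof (intro conjI allI impI ballI)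
    show "A.subspace ?N"
      by (rule A.subspaceI) (auto simp: distrib_right A.scale_mult_left)
    show "act f x \<in> ?N" if f: "functional sH f" and "x \<in> ?N" for f x
    proof -
      \<comment> \<open>As \<open>h * g * g' = h\<close>, starting from the functional translated by
        \<open>g'\<close> leaves exactly \<open>f\<close> after the translation by \<open>g\<close>.
        The left side vanishes for \<open>x\<close> in the annihilator, so \<open>act f x\<close>
        lies in it too.\<close>
      have "act (\<lambda>h. f (h * g')) (x * a) = act f x * a"
        using act_mult_homogeneous(1)[OF functional_mult(2)[OF f, of g'] a(1), of x] g'
        by (simp add: mult.assoc)
      then show ?thesis using that(2) linear_0'[OF linear_act[OF functional_mult(2)[OF f]]] by simp
    qed
  qed
  moreover have "1 \<notin> ?N" using a(2) by simp
  then have "?N \<noteq> UNIV" by (metis UNIV_I)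
  ultimately have N: "?N = {0}" using simple unfolding left_H_simple_def by blast
  have "a * b - 1 \<in> ?N" by (simp add: left_diff_distrib mult.assoc b)
  then have "a * b = 1" unfolding N by simp
  then show ?thesis using b unfolding invertible_elem_def by blast
qed

lemma right_H_simple_homogeneous_invertible:
  assumes simple: "right_H_simple sH sA \<rho>" and a: "\<rho> a = tens sH sA g a" "a \<noteq> 0"
    and g': "g' * g = 1"
  shows "invertible_elem a"
proof -
  let ?I = "{a * b | b. True}" and ?N = "{b. a * b = 0}"
  have "right_ideal ?I"
    unfolding right_ideal_def
  proof (intro conjI ballI allI)
    show "0 \<in> ?I" by (auto intro: exI[of _ 0])
    show "x + y \<in> ?I" if "x \<in> ?I" "y \<in> ?I" for x y
      using that by (auto simp: distrib_left[symmetric])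
    show "x * c \<in> ?I" if "x \<in> ?I" for c x
      using that by (auto simp: mult.assoc)
  qed
  moreover have "subcomodule sH sA \<rho> ?I"
    unfolding subcomodule_iff
  proof (intro conjI allI impI ballI)
    show "A.subspace ?I"
    proof (rule A.subspaceI)
      show "0 \<in> ?I" by (auto intro: exI[of _ 0])
      show "x + y \<in> ?I" if "x \<in> ?I" "y \<in> ?I" for x y
        using that by (auto simp: distrib_left[symmetric])
      show "sA c x \<in> ?I" if "x \<in> ?I" for c x
        using that by (auto simp: A.scale_mult_right[symmetric])
    qed
    show "act f x \<in> ?I" if "functional sH f" "x \<in> ?I" for f x
      using that act_mult_homogeneous(2)[OF that(1) a(1)] by auto
  qed
  moreover have "a \<in> ?I" by (intro CollectI exI[of _ 1]) simp
  then have "?I \<noteq> {0}" using a(2) by (metis singletonD)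
  ultimately have "?I = UNIV" using simple unfolding right_H_simple_def by blast
  then have "1 \<in> ?I" by (simp only: UNIV_I)
  then obtain b where b: "a * b = 1" by auto
  have "right_ideal ?N" unfolding right_ideal_def by (auto simp: distrib_left mult.assoc[symmetric])
  moreover have "subcomodule sH sA \<rho> ?N"
    unfolding subcomodule_iff
  proof (intro conjI allI impI ballI)
    show "A.subspace ?N"
      by (rule A.subspaceI) (auto simp: distrib_left A.scale_mult_right)
    show "act f x \<in> ?N" if f: "functional sH f" and "x \<in> ?N" for f x
    proof -
      \<comment> \<open>On this side the translation is from the left, and
        \<open>g' * g * h = h\<close> calls for a left inverse.\<close>
      have "act (\<lambda>h. f (g' * h)) (a * x) = a * act f x"
        using act_mult_homogeneous(2)[OF functional_mult(1)[OF f, of g'] a(1), of x] g'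
        by (simp add: mult.assoc[symmetric])
      then show ?thesis using that(2) linear_0'[OF linear_act[OF functional_mult(1)[OF f]]] by simp
    qed
  qed
  moreover have "1 \<notin> ?N" using a(2) by simp
  then have "?N \<noteq> UNIV" by (metis UNIV_I)
  ultimately have N: "?N = {0}" using simple unfolding right_H_simple_def by blast
  have "b * a - 1 \<in> ?N" by (simp add: right_diff_distrib mult.assoc[symmetric] b)
  then have "b * a = 1" unfolding N by simp
  then show ?thesis using b unfolding invertible_elem_def by blast
qed

lemma pointed_homogeneous_invertible_H_simple:
  assumes pointed: "pointed sH \<Delta>" and inv: "homogeneous_invertible sH \<Delta> \<epsilon> sA \<rho>"
  shows "left_H_simple sH sA \<rho>" "right_H_simple sH sA \<rho>"
proof -
  \<comment> \<open>Stated for subcomodules without an ideal condition, so that it serves left and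
    right ideals alike.\<close>
  have "\<exists>u\<in>I. invertible_elem u" if "subcomodule sH sA \<rho> I" "I \<noteq> {0}" for I
    using pointed_subcomodule_weight[OF pointed that] inv
    unfolding homogeneous_invertible_def homogeneous_part_def by blast
  then show "left_H_simple sH sA \<rho>" "right_H_simple sH sA \<rho>"
    using inv invertible_mem_left_ideal invertible_mem_right_ideal
    unfolding left_H_simple_def right_H_simple_def homogeneous_invertible_def by metis+
qed

end

text \<open>At a grouplike the coproduct is a single pure tensor, so the antipode laws become
  equations between plain products, with right-hand side 1 because
  \<open>\<epsilon> g = 1\<close>.\<close>

lemma (in hopf_algebra) grouplike_inverse:
  assumes "g \<in> grouplikes sH \<Delta> \<epsilon>"
  shows "S g * g = 1" "g * S g = 1"
proof -
  have g: "\<Delta> g = tens sH sH g g" "\<epsilon> g = 1" using assms by (auto simp: grouplikes_def)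
  note linS = linear_add'[OF antipode_linear] linear_scale'[OF antipode_linear]
  have "bilinear_map sH sH sH (\<lambda>x y. S x * y)" "bilinear_map sH sH sH (\<lambda>x y. x * S y)"
    by (simp_all add: bilinear_map_def Vector_Spaces.linear_iff vector_space_axioms linS
        distrib_left distrib_right scale_mult_left scale_mult_right)
  from this[THEN tensor_lift_tens[OF vector_space_axioms]]
  show "S g * g = 1" "g * S g = 1"
    using antipode_left[of g] antipode_right[of g] by (simp_all add: g)
qed

theorem proposition4p8:
  fixes sH :: "'k::field \<Rightarrow> 'h::{ring,monoid_mult} \<Rightarrow> 'h"
    and \<Delta> :: "'h \<Rightarrow> ('k, 'h, 'h) tensor"
    and \<epsilon> :: "'h \<Rightarrow> 'k"
    and S :: "'h \<Rightarrow> 'h"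
    and sA :: "'k \<Rightarrow> 'a::{ring,monoid_mult} \<Rightarrow> 'a"
    and \<rho> :: "'a \<Rightarrow> ('k, 'h, 'a) tensor"
  assumes "hopf_algebra sH \<Delta> \<epsilon> S"
    and "left_comodule_algebra sH \<Delta> \<epsilon> sA \<rho>"
  shows "(left_H_simple sH sA \<rho> \<longrightarrow> homogeneous_invertible sH \<Delta> \<epsilon> sA \<rho>) \<and>
    (right_H_simple sH sA \<rho> \<longrightarrow> homogeneous_invertible sH \<Delta> \<epsilon> sA \<rho>) \<and>
    (pointed sH \<Delta> \<longrightarrow>
      (left_H_simple sH sA \<rho> \<longleftrightarrow> right_H_simple sH sA \<rho>) \<and>
      (right_H_simple sH sA \<rho> \<longleftrightarrow> homogeneous_invertible sH \<Delta> \<epsilon> sA \<rho>))"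
proof -
  interpret H: hopf_algebra sH \<Delta> \<epsilon> S by fact
  interpret left_comodule_algebra sH \<Delta> \<epsilon> sA \<rho> by fact
  \<comment> \<open>Here \<open>S g\<close> serves as a right inverse of the degree, and in the
    right-hand case below as a left inverse.\<close>
  have left: "homogeneous_invertible sH \<Delta> \<epsilon> sA \<rho>" if simple: "left_H_simple sH sA \<rho>"
    using simple left_H_simple_homogeneous_invertible[OF simple _ _ H.grouplike_inverse(2)]
    by (auto simp: homogeneous_invertible_def homogeneous_part_def left_H_simple_def)
  have right: "homogeneous_invertible sH \<Delta> \<epsilon> sA \<rho>" if simple: "right_H_simple sH sA \<rho>"
    using simple right_H_simple_homogeneous_invertible[OF simple _ _ H.grouplike_inverse(1)]
    by (auto simp: homogeneous_invertible_def homogeneous_part_def right_H_simple_def)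
  show ?thesis
    using left right pointed_homogeneous_invertible_H_simple by blast
qed

end
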